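(* For every $\alpha\in(0,1)$ and $\gamma>0$, one has $$h_{\alpha,\gamma}(x)\;\sim\;c_{\alpha,\gamma}\,x^{-\frac{\gamma}{1-\alpha}-1}\,e^{-((1-\alpha)x)^{-\gamma}}\qquad\text{as }x\to0^+,$$ (i.e. the ratio of the two sides tends to $1$), where $$c_{\alpha,\gamma}\;=\;\gamma\,(1-\alpha)^{\frac{\gamma}{\alpha-1}}\,e^{\frac{\alpha\psi(1)}{\alpha-1}}\,\prod_{k=1}^\infty\frac{e^{\frac{\alpha}{(\alpha-1)k}}}{G_{\alpha,\gamma}(k)}\;\in\;(0,\infty),\qquad G_{\alpha,\gamma}(k)\;=\;{}_2F_1\!\left(\gamma,1;1+k\gamma;\frac{\alpha}{\alpha-1}\right).$$
   Context: For $\alpha\in(0,1)$ and $\gamma>0$, $h_{\alpha,\gamma}$ denotes the smooth probability density on $(0,\infty)$ of the $\alpha$-Sun random variable (Fréchet case), which solves the integro-differential equation $$h_{\alpha,\gamma}(x)=\frac{\gamma}{x}\int_0^x\frac{h_{\alpha,\gamma}(u)}{(x-\alpha u)^{\gamma}}\,du,\qquad x>0.$$ (It is known that such a density exists, and the equation together with $\int_0^\infty h_{\alpha,\gamma}(x)\,dx=1$ determines the law.) Here $\psi$ is the digamma function, so that $\psi(1)$ is the negative of Euler's constant, and ${}_2F_1$ is the Gauss hypergeometric function (analytically continued to $\mathbb{C}\setminus[1,\infty)$); by Euler's integral formula, $${}_2F_1(\gamma,1;1+k\gamma;z)=k\gamma\int_0^1(1-t)^{k\gamma-1}(1-zt)^{-\gamma}\,dt\qquad\text{for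 real } z<1.$$ *)

theory Defs
  imports "HOL-Complex_Analysis.Complex_Analysis"
begin

(* The Gauss hypergeometric function 2F1(a, b; c; z): the analytic continuation of the
   hypergeometric series from the unit disc to the complex plane cut along [1, \<infinity>).
   The value is determined uniquely for z off the cut (c not a non-positive integer);
   on the cut it is unspecified. *)
definition hyp2F1 :: "complex \<Rightarrow> complex \<Rightarrow> complex \<Rightarrow> complex \<Rightarrow> complex" where
  "hyp2F1 a b c =
     (SOME F. F holomorphic_on - (complex_of_real ` {1..}) \<and>
        (\<forall>z\<in>ball 0 1.
           (\<lambda>n. pochhammer a n * pochhammer b n / (pochhammer c n * fact n) * z ^ n) sums F z))"

(* All arguments are real and the last one is negative, so the value of hyp2F1 is real and
   Re only changes its type. *)
definition sun_G :: "real \<Rightarrow> real \<Rightarrow> nat \<Rightarrow> real" where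
  "sun_G \<alpha> \<gamma> k =
     Re (hyp2F1 (of_real \<gamma>) 1 (1 + of_nat k * of_real \<gamma>) (of_real (\<alpha> / (\<alpha> - 1))))"

definition sun_factor :: "real \<Rightarrow> real \<Rightarrow> nat \<Rightarrow> real" where
  "sun_factor \<alpha> \<gamma> k = exp (\<alpha> / ((\<alpha> - 1) * real k)) / sun_G \<alpha> \<gamma> k"

(* Library products start at index 0, the mathematical one at 1; hence the Suc. *)
definition sun_const :: "real \<Rightarrow> real \<Rightarrow> real" where
  "sun_const \<alpha> \<gamma> =
     \<gamma> * (1 - \<alpha>) powr (\<gamma> / (\<alpha> - 1)) * exp (\<alpha> * Digamma 1 / (\<alpha> - 1)) *
     (\<Prod>k. sun_factor \<alpha> \<gamma> (Suc k))"

(* h is the smooth density on (0, \<infinity>) of the \<alpha>-Sun law (Frechet case); its values at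
   x \<le> 0 are irrelevant.  The integrand of the equation is automatically integrable,
   since (x - \<alpha> u) powr \<gamma> is bounded below by ((1 - \<alpha>) x) powr \<gamma> on (0, x). *)
definition sun_density :: "real \<Rightarrow> real \<Rightarrow> (real \<Rightarrow> real) \<Rightarrow> bool" where
  "sun_density \<alpha> \<gamma> h \<longleftrightarrow>
     (\<forall>n. (deriv ^^ n) h differentiable_on {0<..}) \<and>
     (\<forall>x>0. h x \<ge> 0) \<and>
     set_integrable lborel {0<..} h \<and>
     (LBINT x:{0<..}. h x) = 1 \<and>
     (\<forall>x>0. h x = \<gamma> / x * (LBINT u:{0<..<x}. h u / (x - \<alpha> * u) powr \<gamma>))"

end

theory Submission
  imports Defs
begin

text \<open>
  Put \<open>Y(x) = ((1 - \<alpha>) x) powr (-\<gamma>)\<close>, \<open>a = \<alpha> / (1 - \<alpha>)\<close> and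
  \<open>\<Phi>(x) = h(x) x powr (\<gamma> / (1 - \<alpha>) + 1) exp (Y(x))\<close>.  For \<open>0 < u < x\<close> the kernel satisfies
  \<open>(1 - \<alpha>) x \<le> x - \<alpha> u\<close>, so the logarithmic derivative in \<open>x\<close> of \<open>(x - \<alpha> u) powr (-\<gamma>)\<close> is at
  least \<open>-\<gamma> / ((1 - \<alpha>) x)\<close>; differentiating the integral equation, this shows that \<open>\<Phi>\<close> is
  nondecreasing.  Hence \<open>\<Phi>\<close> has a limit \<open>L \<ge> 0\<close> at \<open>0+\<close>, and it remains to identify \<open>L\<close>.
  By Tonelli the equation yields the recursion \<open>E Y^n = E Y^(n+1) G(n+1) / (n+1)\<close>, so
  \<open>E Y^n = n! / (G(1) \<cdots> G(n))\<close>.  On the other hand writing \<open>h\<close> as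
  \<open>x powr (-\<gamma> / (1 - \<alpha>) - 1) exp (-Y(x)) \<Phi>(x)\<close>, the limit \<open>\<Phi> \<rightarrow> L\<close> gives \<open>E Y^n \<sim> L (1 - \<alpha>) powr (\<gamma> / (1 - \<alpha>)) / \<gamma> \<cdot> \<Gamma>(n + a + 1)\<close>.  Comparing
  the two shows that the partial products converge and expresses \<open>L\<close> through their limit;
  the bound \<open>G(k) \<le> 1 - a/k + O(1/k^2)\<close> shows \<open>L > 0\<close>.
\<close>

section \<open>The hypergeometric factor\<close>

text \<open>
  Substituting \<open>1 - t powr (1 / \<gamma>)\<close> for the integration variable, Euler's integral for
  \<open>hyp2F1 \<gamma> 1 (1 + k\<gamma>) z\<close> becomes the integral of
  \<open>k t^(k-1) (1 - z root_gap \<gamma> t) powr (-\<gamma>)\<close> over \<open>{0..1}\<close>, whose integrand has no singularity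
  at the end points even if \<open>k\<gamma> < 1\<close>.
\<close>

definition root_gap :: "real \<Rightarrow> real \<Rightarrow> real" where
  "root_gap \<gamma> t = 1 - t powr (1 / \<gamma>)"

lemma root_gap_bounds:
  assumes "\<gamma> > 0" "0 \<le> t" "t \<le> 1"
  shows "0 \<le> root_gap \<gamma> t" "root_gap \<gamma> t \<le> 1"
  using assms powr_mono2[of "1 / \<gamma>" t 1] by (auto simp: root_gap_def)

lemma continuous_on_root_gap [continuous_intros]:
  assumes "\<gamma> > 0" "continuous_on A f" "\<And>x. x \<in> A \<Longrightarrow> 0 \<le> f x"
  shows "continuous_on A (\<lambda>x. root_gap \<gamma> (f x))"
  unfolding root_gap_def using assms
  by (auto intro!: continuous_intros continuous_on_powr')

text \<open>Integration by parts in disguise: differentiating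
  \<open>t ^ k * root_gap \<gamma> t ^ Suc n\<close> links consecutive exponents and yields the
  ratio \<open>(n + 1) / (k \<gamma> + n + 1)\<close>. The value is the Beta integral
  \<open>k \<gamma> B(k \<gamma>, n + 1)\<close>, which supplies the denominators of the
  hypergeometric coefficients.\<close>

lemma has_integral_root_gap_power:
  assumes "\<gamma> > 0" "k > 0"
  shows "((\<lambda>t. real k * t ^ (k - 1) * root_gap \<gamma> t ^ n) has_integral
           fact n / pochhammer (1 + real k * \<gamma>) n) {0..1}"
proof (induction n)
  case 0
  have "((\<lambda>t. real k * t ^ (k - 1)) has_integral 1 ^ k - 0 ^ k) {0..1::real}"
    by (rule fundamental_theorem_of_calculus)
       (auto intro!: derivative_eq_intros simp flip: has_real_derivative_iff_has_vector_derivative)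
  then show ?case using assms by (simp add: zero_power)
next
  case (Suc n)
  define f where "f = (\<lambda>m t. real k * t ^ (k - 1) * root_gap \<gamma> t ^ m)"
  define J where "J = (\<lambda>m. integral {0..1} (f m))"
  have cont: "continuous_on {0..1} (f m)" for m
    unfolding f_def using assms by (auto intro!: continuous_intros)
  then have J: "(f m has_integral J m) {0..1}" for m
    unfolding J_def by (simp add: integrable_continuous_real integrable_integral)
  define c where "c = real (Suc n) / (real k * \<gamma>)"
  have c: "c > 0" using assms by (simp add: c_def)
  \<comment> \<open>The primitive vanishes at 0 because \<open>k > 0\<close> and at 1 because
    \<open>root_gap \<gamma> 1 = 0\<close>. The interior form of the theorem is used since
    \<open>t powr (1 / \<gamma>)\<close> may fail to be differentiable at 0.\<close>
  have "((\<lambda>t. f (Suc n) t - c * (f n t - f (Suc n) t)) has_integral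
          1 ^ k * root_gap \<gamma> 1 ^ Suc n - 0 ^ k * root_gap \<gamma> 0 ^ Suc n) {0..1}"
  proof (rule fundamental_theorem_of_calculus_interior)
    show "continuous_on {0..1} (\<lambda>t. t ^ k * root_gap \<gamma> t ^ Suc n)"
      using assms by (intro continuous_intros) auto
    fix t :: real assume t: "t \<in> {0<..<1}"
    have tk: "t ^ k = t * t ^ (k - 1)" using assms by (cases k) auto
    have tp: "t * t powr (1 / \<gamma> - 1) = t powr (1 / \<gamma>)"
      using t by (simp add: powr_mult_base)
    have "((\<lambda>t. t ^ k * root_gap \<gamma> t ^ Suc n) has_real_derivative
            real k * t ^ (k - 1) * root_gap \<gamma> t ^ Suc n +
            t ^ k * (real (Suc n) * root_gap \<gamma> t ^ n * (- (1 / \<gamma> * t powr (1 / \<gamma> - 1))))) (at t)"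
      unfolding root_gap_def using t
      by (auto intro!: derivative_eq_intros simp del: power_Suc)
    also have "t ^ k * (real (Suc n) * root_gap \<gamma> t ^ n * (- (1 / \<gamma> * t powr (1 / \<gamma> - 1)))) =
        - (c * (real k * t ^ (k - 1) * root_gap \<gamma> t ^ n * (t * t powr (1 / \<gamma> - 1))))"
      using assms by (simp add: c_def tk field_simps)
    also have "t * t powr (1 / \<gamma> - 1) = 1 - root_gap \<gamma> t"
      by (simp only: tp) (simp add: root_gap_def)
    finally show "((\<lambda>t. t ^ k * root_gap \<gamma> t ^ Suc n) has_vector_derivative
        f (Suc n) t - c * (f n t - f (Suc n) t)) (at t)"
      by (simp add: f_def algebra_simps flip: has_real_derivative_iff_has_vector_derivative)
  qed auto
  then have "((\<lambda>t. f (Suc n) t - c * (f n t - f (Suc n) t)) has_integral 0) {0..1}"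
    using assms by (simp add: root_gap_def zero_power)
  moreover have "((\<lambda>t. f (Suc n) t - c * (f n t - f (Suc n) t)) has_integral
                   J (Suc n) - c * (J n - J (Suc n))) {0..1}"
    by (intro has_integral_diff has_integral_mult_right J)
  ultimately have "J (Suc n) - c * (J n - J (Suc n)) = 0"
    using has_integral_unique by blast
  moreover have "J n = fact n / pochhammer (1 + real k * \<gamma>) n"
    using Suc.IH J[of n] has_integral_unique unfolding f_def by blast
  ultimately have "J (Suc n) * (1 + c) = c * (fact n / pochhammer (1 + real k * \<gamma>) n)"
    by (simp add: algebra_simps)
  then have "J (Suc n) = (c / (1 + c)) * (fact n / pochhammer (1 + real k * \<gamma>) n)"
    using c by (subst times_divide_eq_left, subst eq_divide_eq) auto
  also have "c / (1 + c) = real (Suc n) / (real k * \<gamma> + real (Suc n))"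
  proof -
    have "m / d / (1 + m / d) = m / (d + m)" if "d > 0" "m > 0" for m d :: real
      using that by (simp add: divide_simps)
    then show ?thesis unfolding c_def using assms by simp
  qed
  also have "\<dots> * (fact n / pochhammer (1 + real k * \<gamma>) n) =
      fact (Suc n) / pochhammer (1 + real k * \<gamma>) (Suc n)"
    by (simp add: pochhammer_Suc algebra_simps)
  finally show ?case using J[of "Suc n"] by (simp add: f_def)
qed

section \<open>Euler's integral as the analytic continuation of the hypergeometric series\<close>

definition slit_plane :: "complex set" where
  "slit_plane = - (complex_of_real ` {1..})"

definition euler_integral :: "real \<Rightarrow> nat \<Rightarrow> complex \<Rightarrow> complex" where
  "euler_integral \<gamma> k z =
     integral {0..1} (\<lambda>t. of_real (real k * t ^ (k - 1)) *
                          (1 - z * of_real (root_gap \<gamma> t)) powr (- of_real \<gamma>))"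

text \<open>Keeps the base of the power in \<open>euler_integral\<close> off the branch cut:
  otherwise \<open>z s\<close> would be real and at least 1 with \<open>s \<le> 1\<close>, forcing
  \<open>z\<close> into the slit.\<close>

lemma slit_plane_not_nonpos:
  assumes "z \<in> slit_plane" "0 \<le> s" "s \<le> 1"
  shows "1 - z * of_real s \<notin> \<real>\<^sub>\<le>\<^sub>0"
proof
  assume "1 - z * of_real s \<in> \<real>\<^sub>\<le>\<^sub>0"
  then have re: "1 \<le> Re z * s" and im: "Im z * s = 0"
    by (auto simp: complex_nonpos_Reals_iff)
  with assms have "s > 0" by (cases "s = 0") auto
  with im have "z = of_real (Re z)" by (simp add: complex_eq_iff)
  moreover have "Re z \<ge> 1"
  proof (rule ccontr)
    assume "\<not> Re z \<ge> 1"
    then have "Re z * s < 1 * s" using \<open>s > 0\<close> by (intro mult_strict_right_mono) auto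
    with re assms show False by simp
  qed
  ultimately have "z \<in> complex_of_real ` {1..}" by (metis atLeast_iff imageI)
  with assms show False by (simp add: slit_plane_def)
qed

lemma closed_slit: "closed (complex_of_real ` {1..})"
proof -
  have "complex_of_real ` {1..} = {z. Im z = 0} \<inter> {z. Re z \<ge> 1}"
    by (auto simp: complex_eq_iff image_iff)
  then show ?thesis
    by (simp add: closed_Int closed_Collect_eq closed_halfspace_Re_ge continuous_intros)
qed

lemma open_slit_plane: "open slit_plane"
  using closed_slit by (simp add: open_Compl slit_plane_def)

text \<open>The set is star-shaped about 0: scaling a point by a factor in \<open>[0, 1]\<close>
  cannot move it into the slit, by \<open>slit_plane_not_nonpos\<close>.\<close>

lemma connected_slit_plane: "connected slit_plane"
proof (rule starlike_imp_connected)
  have "r *\<^sub>R z \<in> slit_plane" if "z \<in> slit_plane" "0 \<le> r" "r \<le> 1" for z r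
  proof (rule ccontr)
    assume "r *\<^sub>R z \<notin> slit_plane"
    then obtain y where y: "r *\<^sub>R z = of_real y" "y \<ge> 1" by (auto simp: slit_plane_def)
    then have "1 - z * of_real r \<in> \<real>\<^sub>\<le>\<^sub>0"
      by (simp add: scaleR_conv_of_real mult.commute complex_nonpos_Reals_iff)
    with slit_plane_not_nonpos[of z r] that show False by auto
  qed
  then have "closed_segment 0 z \<subseteq> slit_plane" if "z \<in> slit_plane" for z
    using that unfolding closed_segment_def by auto
  moreover have "0 \<in> slit_plane" by (auto simp: slit_plane_def)
  ultimately show "starlike slit_plane"
    unfolding starlike_def by blast
qed

lemma continuous_on_powr_const_complex:
  fixes f :: "'a :: topological_space \<Rightarrow> complex"
  assumes "continuous_on A f" "\<And>x. x \<in> A \<Longrightarrow> f x \<notin> \<real>\<^sub>\<le>\<^sub>0"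
  shows "continuous_on A (\<lambda>x. f x powr c)"
proof -
  have "continuous_on A (\<lambda>x. exp (c * Ln (f x)))"
    using assms by (intro continuous_intros) auto
  moreover have "f x powr c = exp (c * Ln (f x))" if "x \<in> A" for x
    using assms(2)[OF that] by (auto simp: powr_def)
  ultimately show ?thesis by (simp cong: continuous_on_cong)
qed

text \<open>Differentiation under the integral sign, done on a ball around each point because the
  Leibniz rule asks for a convex domain and the slit plane is not convex.\<close>

lemma euler_integral_holomorphic:
  assumes "\<gamma> > 0"
  shows "euler_integral \<gamma> k holomorphic_on slit_plane"
proof -
  let ?S = slit_plane
  define f where "f = (\<lambda>z t. complex_of_real (real k * t ^ (k - 1)) *
                          (1 - z * of_real (root_gap \<gamma> t)) powr (- of_real \<gamma>))"
  define f' where "f' = (\<lambda>z t. complex_of_real (real k * t ^ (k - 1)) *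
        (of_real \<gamma> * of_real (root_gap \<gamma> t) * (1 - z * of_real (root_gap \<gamma> t)) powr (- of_real \<gamma> - 1)))"
  have np: "1 - z * of_real (root_gap \<gamma> t) \<notin> \<real>\<^sub>\<le>\<^sub>0" if "z \<in> ?S" "t \<in> {0..1}" for z t
    using that assms root_gap_bounds[of \<gamma> t] by (intro slit_plane_not_nonpos) auto
  have "euler_integral \<gamma> k field_differentiable (at z)" if z: "z \<in> ?S" for z
  proof -
    obtain e where e: "e > 0" "ball z e \<subseteq> ?S" using openE[OF open_slit_plane z] by blast
    have np': "1 - w * of_real (root_gap \<gamma> t) \<notin> \<real>\<^sub>\<le>\<^sub>0" if "w \<in> ball z e" "t \<in> {0..1}" for w t
      using that e(2) by (intro np) blast+
    have "(\<lambda>z. integral (cbox 0 1) (f z)) holomorphic_on ball z e"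
    proof (rule leibniz_rule_holomorphic)
      fix w t assume "w \<in> ball z e" "t \<in> cbox 0 (1::real)"
      then have "1 - w * of_real (root_gap \<gamma> t) \<notin> \<real>\<^sub>\<le>\<^sub>0" by (intro np') auto
      then show "((\<lambda>x. f x t) has_field_derivative f' w t) (at w within ball z e)"
        unfolding f_def f'_def by (auto intro!: derivative_eq_intros)
    next
      fix w assume "w \<in> ball z e"
      then have "continuous_on {0..1} (f w)"
        unfolding f_def using assms
        by (intro continuous_on_powr_const_complex continuous_intros np') auto
      then show "f w integrable_on cbox 0 1"
        by (simp add: integrable_continuous_real)
    next
      show "continuous_on (ball z e \<times> cbox 0 1) (\<lambda>(x, t). f' x t)"
        unfolding f'_def case_prod_unfold using assms
        by (intro continuous_on_powr_const_complex continuous_intros np') auto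
    qed auto
    moreover have "(\<lambda>z. integral (cbox 0 1) (f z)) = euler_integral \<gamma> k"
      by (auto simp: f_def euler_integral_def)
    ultimately show ?thesis using e
      by (metis centre_in_ball holomorphic_on_imp_differentiable_at open_ball)
  qed
  then show ?thesis
    by (simp add: holomorphic_on_def field_differentiable_at_within)
qed

text \<open>Expand the power in its binomial series and integrate term by term;
  \<open>has_integral_root_gap_power\<close> evaluates each term.\<close>

lemma euler_integral_sums:
  assumes "\<gamma> > 0" "k > 0" "norm z < 1"
  shows "(\<lambda>n. pochhammer (of_real \<gamma>) n * pochhammer 1 n /
              (pochhammer (1 + of_nat k * of_real \<gamma>) n * fact n) * z ^ n) sums euler_integral \<gamma> k z"
proof -
  define p where "p = (\<lambda>n. pochhammer \<gamma> n / fact n)"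
  have p0: "p n \<ge> 0" for n using assms by (simp add: p_def pochhammer_nonneg)
  define q where "q = (\<lambda>n t. real k * t ^ (k - 1) * root_gap \<gamma> t ^ n)"
  define g where "g = (\<lambda>n t. complex_of_real (p n) * z ^ n * complex_of_real (q n t))"
  define f where "f = (\<lambda>t. complex_of_real (real k * t ^ (k - 1)) *
                          (1 - z * of_real (root_gap \<gamma> t)) powr (- of_real \<gamma>))"
  \<comment> \<open>The sign is absorbed by the \<open>n\<close>-th power of
    \<open>- z * root_gap \<gamma> t\<close>, so all coefficients \<open>p n\<close> are nonnegative
    and can serve in the majorant.\<close>
  have gb: "complex_of_real (p n) = (-1) ^ n * ((- of_real \<gamma>) gchoose n)" for n
    by (simp add: p_def gbinomial_pochhammer pochhammer_of_real)
  have g_sums: "(\<lambda>n. g n t) sums f t" if "t \<in> {0..1}" for t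
  proof -
    have "norm (- z * of_real (root_gap \<gamma> t)) < 1"
      using assms root_gap_bounds[of \<gamma> t] that
      by (simp add: norm_mult) (smt (verit) mult_left_le norm_ge_zero)
    from gen_binomial_complex[OF this, of "- of_real \<gamma>"]
    have "(\<lambda>n. complex_of_real (p n) * z ^ n * of_real (root_gap \<gamma> t) ^ n) sums
            (1 - z * of_real (root_gap \<gamma> t)) powr (- of_real \<gamma>)"
      by (simp add: gb power_mult_distrib power_minus' mult_ac)
    from sums_mult[OF this, of "complex_of_real (real k * t ^ (k - 1))"]
    show ?thesis by (simp add: g_def q_def f_def mult_ac)
  qed
  have q_bound: "0 \<le> q n t" "q n t \<le> k" if "t \<in> {0..1}" for n t
  proof -
    have "t ^ (k - 1) * root_gap \<gamma> t ^ n \<le> 1 * 1"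
      using that assms root_gap_bounds[of \<gamma> t]
      by (intro mult_mono power_le_one) auto
    from mult_left_mono[OF this, of "real k"] show "q n t \<le> k" by (simp add: q_def mult_ac)
    show "0 \<le> q n t" using that assms root_gap_bounds[of \<gamma> t] by (simp add: q_def)
  qed
  \<comment> \<open>The majorant for the Weierstrass test is \<open>k\<close> times the real
    binomial series at \<open>- norm z\<close>.\<close>
  have summ: "summable (\<lambda>n. real k * (p n * norm z ^ n))"
  proof -
    have "(\<lambda>n. ((- \<gamma>) gchoose n) * (- norm z) ^ n) sums (1 + (- norm z)) powr (- \<gamma>)"
      using assms by (intro gen_binomial_real) auto
    moreover have "((- \<gamma>) gchoose n) * (- norm z) ^ n = p n * norm z ^ n" for n
      by (simp add: p_def gbinomial_pochhammer power_minus[of "norm z"])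
    ultimately have "(\<lambda>n. p n * norm z ^ n) sums (1 + (- norm z)) powr (- \<gamma>)"
      by simp
    then show ?thesis by (intro summable_mult) (auto simp: sums_iff)
  qed
  have "uniform_limit {0..1} (\<lambda>N t. \<Sum>n<N. g n t) (\<lambda>t. \<Sum>n. g n t) sequentially"
  proof (rule Weierstrass_m_test[OF _ summ])
    fix n and t :: real assume t: "t \<in> {0..1}"
    have "norm (g n t) = p n * norm z ^ n * q n t"
      using p0 q_bound[OF t] by (simp add: g_def norm_mult norm_power)
    also have "\<dots> \<le> p n * norm z ^ n * k"
      using p0 q_bound[OF t] by (intro mult_left_mono) auto
    finally show "norm (g n t) \<le> real k * (p n * norm z ^ n)" by (simp add: mult_ac)
  qed
  moreover have "continuous_on {0..1} (\<lambda>t. \<Sum>n<N. g n t)" for N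
    unfolding g_def q_def using assms by (intro continuous_intros) auto
  ultimately obtain I J where IJ: "\<And>N. ((\<lambda>t. \<Sum>n<N. g n t) has_integral I N) {0..1}"
    "((\<lambda>t. \<Sum>n. g n t) has_integral J) {0..1}" "I \<longlonglongrightarrow> J"
    by (rule uniform_limit_integral) auto
  have "(f has_integral J) {0..1}"
    using IJ(2) by (rule has_integral_eq_rhs[OF has_integral_eq, rotated])
                   (use g_sums in \<open>auto simp: sums_iff\<close>)
  then have J: "J = euler_integral \<gamma> k z"
    by (simp add: euler_integral_def f_def integral_unique)
  have "(g n has_integral (complex_of_real (p n) * z ^ n *
           of_real (fact n / pochhammer (1 + real k * \<gamma>) n))) {0..1}" for n
    unfolding g_def q_def
    by (intro has_integral_mult_right has_integral_of_real has_integral_root_gap_power assms)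
  then have "((\<lambda>t. \<Sum>n<N. g n t) has_integral (\<Sum>n<N. complex_of_real (p n) * z ^ n *
           of_real (fact n / pochhammer (1 + real k * \<gamma>) n))) {0..1}" for N
    by (intro has_integral_sum) auto
  then have I: "I N = (\<Sum>n<N. complex_of_real (p n) * z ^ n *
           of_real (fact n / pochhammer (1 + real k * \<gamma>) n))" for N
    using IJ(1) has_integral_unique by blast
  have *: "complex_of_real (p n) * z ^ n * of_real (fact n / pochhammer (1 + real k * \<gamma>) n) =
        pochhammer (of_real \<gamma>) n * pochhammer 1 n /
              (pochhammer (1 + of_nat k * of_real \<gamma>) n * fact n) * z ^ n" for n
  proof -
    have "pochhammer (1 + of_nat k * of_real \<gamma>) n = complex_of_real (pochhammer (1 + real k * \<gamma>) n)"
      using pochhammer_of_real[of "1 + real k * \<gamma>" n, where 'a = complex] by simp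
    then show ?thesis
      by (simp add: p_def pochhammer_of_real flip: pochhammer_fact)
  qed
  show ?thesis using IJ(3) unfolding sums_def J[symmetric] I * .
qed

text \<open>\<open>euler_integral\<close> witnesses that the description behind \<open>SOME\<close>
  is satisfiable, so the chosen function satisfies it too; both have the same power series on the
  unit disc, and the identity theorem extends the equality to the connected slit plane.\<close>

lemma hyp2F1_eq_euler_integral:
  assumes "\<gamma> > 0" "k > 0" "z \<in> slit_plane"
  shows "hyp2F1 (of_real \<gamma>) 1 (1 + of_nat k * of_real \<gamma>) z = euler_integral \<gamma> k z"
proof -
  let ?S = slit_plane
  define P where "P = (\<lambda>F. F holomorphic_on ?S \<and> (\<forall>z\<in>ball 0 1.
     (\<lambda>n. pochhammer (of_real \<gamma>) n * pochhammer 1 n /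
              (pochhammer (1 + of_nat k * of_real \<gamma>) n * fact n) * z ^ n) sums F z))"
  have E: "P (euler_integral \<gamma> k)"
    unfolding P_def using euler_integral_holomorphic euler_integral_sums assms by simp
  have "hyp2F1 (of_real \<gamma>) 1 (1 + of_nat k * of_real \<gamma>) = (SOME F. P F)"
    unfolding hyp2F1_def P_def slit_plane_def ..
  then have H: "P (hyp2F1 (of_real \<gamma>) 1 (1 + of_nat k * of_real \<gamma>))"
    using someI[of P, OF E] by simp
  have sub: "ball 0 1 \<subseteq> ?S" by (auto simp: slit_plane_def)
  show ?thesis
  proof (rule analytic_continuation_open[where f = "hyp2F1 (of_real \<gamma>) 1 (1 + of_nat k * of_real \<gamma>)" and
        g = "euler_integral \<gamma> k", OF open_ball open_slit_plane _ connected_slit_plane sub])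
    fix w :: complex assume "w \<in> ball 0 1"
    then show "hyp2F1 (of_real \<gamma>) 1 (1 + of_nat k * of_real \<gamma>) w = euler_integral \<gamma> k w"
      using E H unfolding P_def by (meson sums_unique2)
  qed (use E H assms in \<open>auto simp: P_def\<close>)
qed

text \<open>At \<open>z = \<alpha> / (\<alpha> - 1) < 0\<close> the base
  \<open>1 - z * root_gap \<gamma> t\<close> is a positive real, so the complex power is the real
  one and \<open>Re\<close> loses nothing.\<close>

lemma sun_G_has_integral:
  assumes "0 < \<alpha>" "\<alpha> < 1" "\<gamma> > 0" "k > 0"
  shows "((\<lambda>t. real k * t ^ (k - 1) * (1 + \<alpha> / (1 - \<alpha>) * root_gap \<gamma> t) powr (- \<gamma>))
           has_integral sun_G \<alpha> \<gamma> k) {0..1}"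
proof -
  define f where "f = (\<lambda>t. real k * t ^ (k - 1) * (1 + \<alpha> / (1 - \<alpha>) * root_gap \<gamma> t) powr (- \<gamma>))"
  have pos: "1 + \<alpha> / (1 - \<alpha>) * root_gap \<gamma> t > 0" if "t \<in> {0..1}" for t
    using that assms root_gap_bounds[of \<gamma> t] by (simp add: add_pos_nonneg)
  have "continuous_on {0..1} f"
    unfolding f_def using assms pos by (intro continuous_intros continuous_on_powr) force+
  then have f: "(f has_integral integral {0..1} f) {0..1}"
    by (simp add: integrable_continuous_real integrable_integral)
  have "((\<lambda>t. complex_of_real (real k * t ^ (k - 1)) *
       (1 - of_real (\<alpha> / (\<alpha> - 1)) * of_real (root_gap \<gamma> t)) powr (- of_real \<gamma>)) has_integral
       of_real (integral {0..1} f)) {0..1}"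
  proof (rule has_integral_eq[OF _ has_integral_of_real[OF f]])
    fix t :: real assume t: "t \<in> {0..1}"
    define X where "X = 1 + \<alpha> / (1 - \<alpha>) * root_gap \<gamma> t"
    have "1 - complex_of_real (\<alpha> / (\<alpha> - 1)) * of_real (root_gap \<gamma> t) = of_real X"
      unfolding X_def using assms by (simp add: divide_simps) (simp add: algebra_simps)
    moreover have "of_real X powr (- of_real \<gamma>) = complex_of_real (X powr (- \<gamma>))"
      using powr_of_real[of X "- \<gamma>"] pos[OF t, folded X_def] by simp
    ultimately show "complex_of_real (f t) = complex_of_real (real k * t ^ (k - 1)) *
       (1 - of_real (\<alpha> / (\<alpha> - 1)) * of_real (root_gap \<gamma> t)) powr (- of_real \<gamma>)"
      by (simp only: f_def X_def[symmetric] of_real_mult)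
  qed
  then have "euler_integral \<gamma> k (of_real (\<alpha> / (\<alpha> - 1))) = of_real (integral {0..1} f)"
    unfolding euler_integral_def by (rule integral_unique)
  moreover have "\<alpha> / (\<alpha> - 1) < 1" using assms by (simp add: divide_simps)
  then have "of_real (\<alpha> / (\<alpha> - 1)) \<in> slit_plane"
    by (auto simp: slit_plane_def simp del: of_real_divide of_real_diff)
  ultimately have "sun_G \<alpha> \<gamma> k = integral {0..1} f"
    using assms hyp2F1_eq_euler_integral unfolding sun_G_def by simp
  with f show ?thesis by (simp add: f_def)
qed

section \<open>Bounds for the hypergeometric factor and for the partial products\<close>

lemma powr_minus_ge_linear:
  assumes "x \<ge> 0" "p \<ge> (0::real)"
  shows "(1 + x) powr (- p) \<ge> 1 - p * x"
proof -
  have "1 - p * x \<le> exp (- (p * x))" using exp_ge_add_one_self[of "- (p * x)"] by simp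
  also have "\<dots> \<le> exp (- p * ln (1 + x))"
    using assms ln_add_one_self_le_self[of x] by (simp add: mult_left_mono)
  also have "\<dots> = (1 + x) powr (- p)" using assms by (simp add: powr_def)
  finally show ?thesis .
qed

text \<open>The difference of the two sides vanishes at 0, and its derivative is nonnegative by
  \<open>powr_minus_ge_linear\<close> with exponent \<open>p + 1\<close>.\<close>

lemma powr_minus_le_quadratic:
  assumes "x \<ge> 0" "p > (0::real)"
  shows "(1 + x) powr (- p) \<le> 1 - p * x + p * (p + 1) / 2 * x ^ 2"
proof -
  define f where "f = (\<lambda>x. 1 - p * x + p * (p + 1) / 2 * x ^ 2 - (1 + x) powr (- p))"
  have "f 0 \<le> f x"
  proof (rule DERIV_nonneg_imp_nondecreasing[OF assms(1)])
    fix y :: real assume y: "0 \<le> y" "y \<le> x"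
    have "(f has_real_derivative - p + p * (p + 1) * y + p * (1 + y) powr (- p - 1)) (at y)"
      unfolding f_def using y by (auto intro!: derivative_eq_intros simp: field_simps)
    moreover have "p * (1 - (p + 1) * y) \<le> p * (1 + y) powr (- p - 1)"
      using assms y powr_minus_ge_linear[of y "p + 1"] by (intro mult_left_mono) auto
    then have "0 \<le> - p + p * (p + 1) * y + p * (1 + y) powr (- p - 1)"
      by (simp add: right_diff_distrib mult.assoc)
    ultimately show "\<exists>d. (f has_real_derivative d) (at y) \<and> 0 \<le> d" by blast
  qed
  then show ?thesis by (simp add: f_def)
qed

text \<open>The quadratic bound on the power is integrated using the values of
  \<open>has_integral_root_gap_power\<close> for \<open>n = 0, 1, 2\<close>. For large
  \<open>k\<close> the right side is \<open>1 - a / k + O(1 / k^2)\<close>.\<close>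

lemma sun_G_le:
  assumes "0 < \<alpha>" "\<alpha> < 1" "\<gamma> > 0" "k > 0"
  defines "a \<equiv> \<alpha> / (1 - \<alpha>)"
  shows "sun_G \<alpha> \<gamma> k \<le> 1 - \<gamma> * a / (1 + real k * \<gamma>) +
           \<gamma> * (\<gamma> + 1) * a\<^sup>2 / ((1 + real k * \<gamma>) * (2 + real k * \<gamma>))"
proof -
  define q where "q = (\<lambda>n t. real k * t ^ (k - 1) * root_gap \<gamma> t ^ n)"
  have a: "a > 0" using assms by (simp add: a_def)
  have q: "(q n has_integral fact n / pochhammer (1 + real k * \<gamma>) n) {0..1}" for n
    unfolding q_def using assms by (intro has_integral_root_gap_power)
  have "((\<lambda>t. q 0 t - \<gamma> * a * q 1 t + \<gamma> * (\<gamma> + 1) / 2 * a\<^sup>2 * q 2 t) has_integral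
      fact 0 / pochhammer (1 + real k * \<gamma>) 0 - \<gamma> * a * (fact 1 / pochhammer (1 + real k * \<gamma>) 1) +
      \<gamma> * (\<gamma> + 1) / 2 * a\<^sup>2 * (fact 2 / pochhammer (1 + real k * \<gamma>) 2)) {0..1}"
    by (intro has_integral_add has_integral_diff has_integral_mult_right q)
  then have "sun_G \<alpha> \<gamma> k \<le> fact 0 / pochhammer (1 + real k * \<gamma>) 0 -
      \<gamma> * a * (fact 1 / pochhammer (1 + real k * \<gamma>) 1) +
      \<gamma> * (\<gamma> + 1) / 2 * a\<^sup>2 * (fact 2 / pochhammer (1 + real k * \<gamma>) 2)"
  proof (rule has_integral_le[OF sun_G_has_integral[OF assms(1-4)]])
    fix t :: real assume t: "t \<in> {0..1}"
    have "(1 + a * root_gap \<gamma> t) powr (- \<gamma>) \<le>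
        1 - \<gamma> * (a * root_gap \<gamma> t) + \<gamma> * (\<gamma> + 1) / 2 * (a * root_gap \<gamma> t) ^ 2"
      using assms a t root_gap_bounds[of \<gamma> t] by (intro powr_minus_le_quadratic) auto
    then have "real k * t ^ (k - 1) * (1 + a * root_gap \<gamma> t) powr (- \<gamma>) \<le> real k * t ^ (k - 1) *
        (1 - \<gamma> * (a * root_gap \<gamma> t) + \<gamma> * (\<gamma> + 1) / 2 * (a * root_gap \<gamma> t) ^ 2)"
      using t by (intro mult_left_mono) auto
    also have "\<dots> = q 0 t - \<gamma> * a * q 1 t + \<gamma> * (\<gamma> + 1) / 2 * a\<^sup>2 * q 2 t"
      by (simp add: q_def algebra_simps power2_eq_square)
    finally show "real k * t ^ (k - 1) * (1 + \<alpha> / (1 - \<alpha>) * root_gap \<gamma> t) powr (- \<gamma>) \<le>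
        q 0 t - \<gamma> * a * q 1 t + \<gamma> * (\<gamma> + 1) / 2 * a\<^sup>2 * q 2 t"
      by (simp add: a_def)
  qed
  moreover have "pochhammer (1 + real k * \<gamma>) 2 = (1 + real k * \<gamma>) * (2 + real k * \<gamma>)"
    by (simp add: pochhammer_Suc numeral_2_eq_2)
  ultimately show ?thesis by (simp add: mult_ac)
qed

text \<open>Since \<open>root_gap \<gamma> t \<le> 1\<close>, the integrand is at least
  \<open>(1 + a) powr (- \<gamma>)\<close> times a density of total mass 1.\<close>

lemma sun_G_pos:
  assumes "0 < \<alpha>" "\<alpha> < 1" "\<gamma> > 0" "k > 0"
  shows "sun_G \<alpha> \<gamma> k > 0"
proof -
  define a where "a = \<alpha> / (1 - \<alpha>)"
  have a: "a > 0" using assms by (simp add: a_def)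
  have "((\<lambda>t. (1 + a) powr (- \<gamma>) * (real k * t ^ (k - 1) * root_gap \<gamma> t ^ 0)) has_integral
      (1 + a) powr (- \<gamma>) * (fact 0 / pochhammer (1 + real k * \<gamma>) 0)) {0..1}"
    using assms by (intro has_integral_mult_right has_integral_root_gap_power)
  then have "(1 + a) powr (- \<gamma>) * (fact 0 / pochhammer (1 + real k * \<gamma>) 0) \<le> sun_G \<alpha> \<gamma> k"
  proof (rule has_integral_le[OF _ sun_G_has_integral[OF assms]])
    fix t :: real assume t: "t \<in> {0..1}"
    have "(1 + a) powr (- \<gamma>) \<le> (1 + a * root_gap \<gamma> t) powr (- \<gamma>)"
      using assms a t root_gap_bounds[of \<gamma> t] mult_left_mono[of "root_gap \<gamma> t" 1 a]
      by (intro powr_mono2') (auto intro: add_pos_nonneg)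
    from mult_left_mono[OF this, of "real k * t ^ (k - 1)"]
    show "(1 + a) powr (- \<gamma>) * (real k * t ^ (k - 1) * root_gap \<gamma> t ^ 0) \<le>
        real k * t ^ (k - 1) * (1 + \<alpha> / (1 - \<alpha>) * root_gap \<gamma> t) powr (- \<gamma>)"
      using t by (simp add: a_def mult_ac)
  qed
  then have "(1 + a) powr (- \<gamma>) \<le> sun_G \<alpha> \<gamma> k" by simp
  moreover have "(1 + a) powr (- \<gamma>) > 0" using a by simp
  ultimately show ?thesis by linarith
qed

text \<open>Since \<open>1 / G \<ge> exp (1 - G)\<close>, a lower bound for \<open>1 - G\<close>
  suffices. Its leading term \<open>\<gamma> a / (1 + k \<gamma>)\<close> cancels the
  \<open>a / k\<close> of the exponential up to \<open>a / (\<gamma> k^2)\<close>, and the quadratic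
  term is also of order \<open>1 / k^2\<close>.\<close>

lemma sun_factor_ge:
  assumes "0 < \<alpha>" "\<alpha> < 1" "\<gamma> > 0" "k > 0"
  defines "a \<equiv> \<alpha> / (1 - \<alpha>)"
  shows "sun_factor \<alpha> \<gamma> k \<ge> exp (- ((a + (\<gamma> + 1) * a\<^sup>2) / \<gamma>) * inverse (real k ^ 2))"
proof -
  define b where "b = real k * \<gamma>"
  have a: "a > 0" and b: "b > 0" using assms by (simp_all add: a_def b_def)
  have "a / real k - \<gamma> * a / (1 + b) = a / (real k * (1 + b))"
  proof -
    have "1 + b \<noteq> 0" using b by linarith
    moreover have "\<gamma> = b / real k" using assms by (simp add: b_def)
    ultimately show ?thesis using assms by (simp add: divide_simps) (simp add: algebra_simps)
  qed
  also have "\<dots> \<le> a / (real k * b)"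
    using a b assms by (intro divide_left_mono) auto
  also have "\<dots> = a / \<gamma> * inverse (real k ^ 2)"
    using assms by (simp add: b_def field_simps power2_eq_square)
  finally have 1: "a / real k - \<gamma> * a / (1 + b) \<le> a / \<gamma> * inverse (real k ^ 2)" .
  have "\<gamma> * (\<gamma> + 1) * a\<^sup>2 / ((1 + b) * (2 + b)) \<le> \<gamma> * (\<gamma> + 1) * a\<^sup>2 / (b * b)"
    using a b assms by (intro divide_left_mono mult_mono) auto
  also have "\<dots> = (\<gamma> + 1) * a\<^sup>2 / \<gamma> * inverse (real k ^ 2)"
    using assms(3,4) by (simp add: b_def field_simps power2_eq_square)
  finally have 2: "\<gamma> * (\<gamma> + 1) * a\<^sup>2 / ((1 + b) * (2 + b)) \<le>
      (\<gamma> + 1) * a\<^sup>2 / \<gamma> * inverse (real k ^ 2)" .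
  have "- ((a + (\<gamma> + 1) * a\<^sup>2) / \<gamma>) * inverse (real k ^ 2) =
      - (a / \<gamma> * inverse (real k ^ 2)) - (\<gamma> + 1) * a\<^sup>2 / \<gamma> * inverse (real k ^ 2)"
    by (simp add: algebra_simps add_divide_distrib)
  also have "\<dots> \<le> - (a / real k) + (1 - sun_G \<alpha> \<gamma> k)"
    using 1 2 sun_G_le[OF assms(1-4)] unfolding a_def[symmetric] b_def[symmetric] by linarith
  also have "- (a / real k) = \<alpha> / ((\<alpha> - 1) * real k)"
    using assms by (simp add: a_def divide_simps) (simp add: algebra_simps)
  finally have "exp (- ((a + (\<gamma> + 1) * a\<^sup>2) / \<gamma>) * inverse (real k ^ 2)) \<le>
      exp (\<alpha> / ((\<alpha> - 1) * real k)) * exp (1 - sun_G \<alpha> \<gamma> k)"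
    by (simp flip: exp_add)
  also have "exp (1 - sun_G \<alpha> \<gamma> k) \<le> 1 / sun_G \<alpha> \<gamma> k"
  proof -
    have "sun_G \<alpha> \<gamma> k \<le> exp (- (1 - sun_G \<alpha> \<gamma> k))"
      using exp_ge_add_one_self[of "sun_G \<alpha> \<gamma> k - 1"] by simp
    then have "sun_G \<alpha> \<gamma> k \<le> 1 / exp (1 - sun_G \<alpha> \<gamma> k)"
      by (simp only: exp_minus inverse_eq_divide)
    then show ?thesis
      using sun_G_pos[OF assms(1-4)] by (simp add: le_divide_eq mult.commute)
  qed
  finally show ?thesis by (simp add: sun_factor_def mult_left_mono)
qed

text \<open>The losses in \<open>sun_factor_ge\<close> are summable. This uniform bound is what
  later excludes \<open>L = 0\<close>.\<close>

lemma sun_factor_prod_bounded_below: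
  assumes "0 < \<alpha>" "\<alpha> < 1" "\<gamma> > 0"
  obtains c where "c > 0" "\<And>n. c \<le> (\<Prod>k<n. sun_factor \<alpha> \<gamma> (Suc k))"
proof
  define C where "C = (\<alpha> / (1 - \<alpha>) + (\<gamma> + 1) * (\<alpha> / (1 - \<alpha>))\<^sup>2) / \<gamma>"
  have C: "C \<ge> 0" using assms by (simp add: C_def)
  have summ: "summable (\<lambda>k. inverse (real (Suc k) ^ 2))"
    using inverse_power_summable[of 2, where 'a = real] by (subst summable_Suc_iff) simp
  fix n
  have "(\<Sum>k<n. inverse (real (Suc k) ^ 2)) \<le> (\<Sum>k. inverse (real (Suc k) ^ 2))"
    by (intro sum_le_suminf summ) auto
  then have "exp (- C * (\<Sum>k. inverse (real (Suc k) ^ 2))) \<le>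
      exp (- C * (\<Sum>k<n. inverse (real (Suc k) ^ 2)))"
    using C by (simp add: mult_left_mono)
  also have "\<dots> = exp (\<Sum>k<n. - C * inverse (real (Suc k) ^ 2))"
    by (simp only: sum_distrib_left)
  also have "\<dots> = (\<Prod>k<n. exp (- C * inverse (real (Suc k) ^ 2)))"
    by (rule exp_sum) simp
  also have "\<dots> \<le> (\<Prod>k<n. sun_factor \<alpha> \<gamma> (Suc k))"
    using sun_factor_ge[OF assms, of "Suc _"] unfolding C_def by (intro prod_mono) auto
  finally show "exp (- C * (\<Sum>k. inverse (real (Suc k) ^ 2))) \<le> (\<Prod>k<n. sun_factor \<alpha> \<gamma> (Suc k))" .
qed simp

section \<open>Monotonicity of the tilted density\<close>

locale sun_law =
  fixes \<alpha> \<gamma> :: real and h :: "real \<Rightarrow> real"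
  assumes alpha_pos: "0 < \<alpha>" and alpha_less: "\<alpha> < 1" and gamma_pos: "\<gamma> > 0"
    and density: "sun_density \<alpha> \<gamma> h"
begin

lemmas params = alpha_pos alpha_less gamma_pos

lemma h_differentiable: "h differentiable_on {0<..}"
  using density unfolding sun_density_def by (metis funpow_0)

lemma h_continuous: "continuous_on {0<..} h"
  using h_differentiable by (rule differentiable_imp_continuous_on)

lemma h_nonneg: "x > 0 \<Longrightarrow> h x \<ge> 0"
  using density unfolding sun_density_def by blast

lemma h_integrable: "set_integrable lborel {0<..} h"
  using density by (simp add: sun_density_def)

lemma h_weighted_integrable:
  assumes "A \<in> sets borel" "A \<subseteq> {0<..}" "g \<in> borel_measurable borel" "\<And>u. u \<in> A \<Longrightarrow> \<bar>g u\<bar> \<le> B"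
  shows "set_integrable lborel A (\<lambda>u. h u * g u)"
  unfolding set_integrable_def
proof (rule Bochner_Integration.integrable_bound)
  have h: "integrable lborel (\<lambda>u. indicator {0<..} u *\<^sub>R h u)"
    using h_integrable by (simp add: set_integrable_def)
  then show "integrable lborel (\<lambda>u. B * (indicator {0<..} u *\<^sub>R h u))" by simp
  have "(\<lambda>u. indicator A u *\<^sub>R (h u * g u)) =
      (\<lambda>u. (indicator {0<..} u *\<^sub>R h u) * (indicator A u * g u))"
    using assms(2) by (auto simp: indicator_def fun_eq_iff)
  moreover have "\<dots> \<in> borel_measurable lborel"
    using borel_measurable_integrable[OF h] assms(1,3) by measurable
  ultimately show "(\<lambda>u. indicator A u *\<^sub>R (h u * g u)) \<in> borel_measurable lborel" by simp
  show "AE u in lborel. norm (indicator A u *\<^sub>R (h u * g u)) \<le>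
          norm (B * (indicator {0<..} u *\<^sub>R h u))"
  proof (rule AE_I2)
    fix u
    show "norm (indicator A u *\<^sub>R (h u * g u)) \<le> norm (B * (indicator {0<..} u *\<^sub>R h u))"
    proof (cases "u \<in> A")
      case True
      with assms have "u > 0" "\<bar>g u\<bar> \<le> \<bar>B\<bar>" by force+
      then show ?thesis using True h_nonneg[of u]
        by (simp add: abs_mult) (metis abs_ge_zero mult.commute mult_left_mono)
    qed auto
  qed
qed

text \<open>The integral of the equation with the quotient written as a negative power. As
  \<open>H x = x h(x) / \<gamma>\<close>, its smoothness comes from that of
  \<open>h\<close>.\<close>

definition H :: "real \<Rightarrow> real" where
  "H x = (LBINT u:{0<..<x}. h u * (x - \<alpha> * u) powr (- \<gamma>))"

lemma h_eq: "x > 0 \<Longrightarrow> h x = \<gamma> / x * H x"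
  using density unfolding sun_density_def H_def by (simp add: powr_minus_divide)

lemma H_eq: "x > 0 \<Longrightarrow> H x = x * h x / \<gamma>"
  using h_eq[of x] gamma_pos by (simp add: field_simps)

lemma kernel_pos: "0 < u \<Longrightarrow> u \<le> x \<Longrightarrow> (1 - \<alpha>) * x > 0 \<and> (1 - \<alpha>) * x \<le> x - \<alpha> * u"
  using params by (simp add: algebra_simps)

lemma kernel_integrable:
  assumes "A \<in> sets borel" "A \<subseteq> {0<..x}"
  shows "set_integrable lborel A (\<lambda>u. h u * (x - \<alpha> * u) powr (- \<gamma>))"
proof (rule h_weighted_integrable)
  show "A \<subseteq> {0<..}" using assms by auto
  show "(\<lambda>u. (x - \<alpha> * u) powr (- \<gamma>)) \<in> borel_measurable borel" by measurable
  fix u assume "u \<in> A"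
  then show "\<bar>(x - \<alpha> * u) powr (- \<gamma>)\<bar> \<le> ((1 - \<alpha>) * x) powr (- \<gamma>)"
    using assms kernel_pos[of u x] gamma_pos by (auto intro!: powr_mono2')
qed fact

text \<open>
  Both sides agree at \<open>d = 0\<close>, so the inequality passes to the right derivatives there; this
  replaces differentiation under the integral sign.
\<close>

lemma H_increment:
  assumes x: "x > 0" and d: "d \<ge> 0"
  shows "H (x + d) \<ge> H x * (1 + d / ((1 - \<alpha>) * x)) powr (- \<gamma>) +
           ((1 - \<alpha>) * x + d) powr (- \<gamma>) * integral {x..x+d} h"
proof -
  define k where "k = (\<lambda>x u. h u * (x - \<alpha> * u) powr (- \<gamma>))"
  have hi: "set_integrable lborel {x..<x+d} h"
    using h_integrable by (rule set_integrable_subset) (use x in auto)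
  \<comment> \<open>The old range of \<open>u\<close> is handled by comparing kernels, the new range
    by bounding the kernel below by its value at \<open>u = x\<close>.\<close>
  have "{0<..<x+d} = {0<..<x} \<union> {x..<x+d}" using x d by auto
  then have "H (x + d) = (LBINT u:{0<..<x} \<union> {x..<x+d}. k (x + d) u)"
    by (simp add: H_def k_def)
  also have "\<dots> = (LBINT u:{0<..<x}. k (x + d) u) + (LBINT u:{x..<x+d}. k (x + d) u)"
    unfolding k_def using x d by (intro set_integral_Un kernel_integrable) auto
  finally have split: "H (x + d) = (LBINT u:{0<..<x}. k (x + d) u) + (LBINT u:{x..<x+d}. k (x + d) u)" .
  have left: "(LBINT u:{0<..<x}. k (x + d) u) \<ge>
      (LBINT u:{0<..<x}. k x u * (1 + d / ((1 - \<alpha>) * x)) powr (- \<gamma>))"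
  proof (rule set_integral_mono)
    show "set_integrable lborel {0<..<x} (\<lambda>u. k x u * (1 + d / ((1 - \<alpha>) * x)) powr (- \<gamma>))"
      unfolding k_def using x by (intro set_integrable_mult_left kernel_integrable) auto
    show "set_integrable lborel {0<..<x} (k (x + d))"
      unfolding k_def using x d by (intro kernel_integrable) auto
    fix u assume u: "u \<in> {0<..<x}"
    \<comment> \<open>This is \<open>(1 - \<alpha>) x \<le> x - \<alpha> u\<close> multiplied by
      \<open>d / ((1 - \<alpha>) x)\<close>, with \<open>x - \<alpha> u\<close> added.\<close>
    have "x + d - \<alpha> * u \<le> (x - \<alpha> * u) * (1 + d / ((1 - \<alpha>) * x))"
    proof -
      have "((1 - \<alpha>) * x) * (d / ((1 - \<alpha>) * x)) \<le> (x - \<alpha> * u) * (d / ((1 - \<alpha>) * x))"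
        using kernel_pos[of u x] u d by (intro mult_right_mono divide_nonneg_nonneg) auto
      moreover have "((1 - \<alpha>) * x) * (d / ((1 - \<alpha>) * x)) = d" using x params by simp
      ultimately show ?thesis by (simp only: distrib_left mult_1_right)
    qed
    then have "((x - \<alpha> * u) * (1 + d / ((1 - \<alpha>) * x))) powr (- \<gamma>) \<le> (x + d - \<alpha> * u) powr (- \<gamma>)"
      using kernel_pos[of u x] u d gamma_pos by (intro powr_mono2') auto
    moreover have "((x - \<alpha> * u) * (1 + d / ((1 - \<alpha>) * x))) powr (- \<gamma>) =
        (x - \<alpha> * u) powr (- \<gamma>) * (1 + d / ((1 - \<alpha>) * x)) powr (- \<gamma>)"
      by (rule powr_mult)
    ultimately show "k x u * (1 + d / ((1 - \<alpha>) * x)) powr (- \<gamma>) \<le> k (x + d) u"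
      unfolding k_def using u h_nonneg[of u] by (simp add: mult.assoc mult_left_mono)
  qed
  moreover have "(LBINT u:{0<..<x}. k x u) = H x"
    by (simp add: H_def k_def)
  moreover have "(LBINT u:{x..<x+d}. k (x + d) u) \<ge> (LBINT u:{x..<x+d}. ((1 - \<alpha>) * x + d) powr (- \<gamma>) * h u)"
  proof (rule set_integral_mono)
    show "set_integrable lborel {x..<x+d} (\<lambda>u. ((1 - \<alpha>) * x + d) powr (- \<gamma>) * h u)"
      using hi by simp
    show "set_integrable lborel {x..<x+d} (k (x + d))"
      unfolding k_def using x d by (intro kernel_integrable) auto
    fix u assume u: "u \<in> {x..<x+d}"
    have "\<alpha> * x \<le> \<alpha> * u" using u params by simp
    then have "((1 - \<alpha>) * x + d) powr (- \<gamma>) \<le> (x + d - \<alpha> * u) powr (- \<gamma>)"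
      using kernel_pos[of u "x + d"] u x d gamma_pos
      by (intro powr_mono2') (auto simp: algebra_simps)
    then show "((1 - \<alpha>) * x + d) powr (- \<gamma>) * h u \<le> k (x + d) u"
      unfolding k_def using u x h_nonneg[of u] by (subst mult.commute) (simp add: mult_left_mono)
  qed
  moreover have "(LBINT u:{x..<x+d}. ((1 - \<alpha>) * x + d) powr (- \<gamma>) * h u) =
      ((1 - \<alpha>) * x + d) powr (- \<gamma>) * (LBINT u:{x..<x+d}. h u)"
    by simp
  moreover have "(LBINT u:{x..<x+d}. h u) = integral {x..x+d} h"
  proof -
    have "(LBINT u:{x..<x+d}. h u) = (LBINT u:{x..x+d}. h u)"
      by (rule set_integral_discrete_difference[where X = "{x + d}"]) auto
    also have "\<dots> = integral {x..x+d} h"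
      by (intro set_borel_integral_eq_integral set_integrable_subset[OF h_integrable]) (use x in auto)
    finally show ?thesis .
  qed
  ultimately show ?thesis unfolding split by simp
qed

definition Phi :: "real \<Rightarrow> real" where
  "Phi x = h x * x powr (\<gamma> / (1 - \<alpha>) + 1) * exp (((1 - \<alpha>) * x) powr (- \<gamma>))"

lemma h_has_derivative:
  assumes "x > 0"
  shows "(h has_real_derivative deriv h x) (at x)"
proof -
  have "h differentiable (at x)"
    using h_differentiable assms
    by (metis differentiable_on_eq_differentiable_at greaterThan_iff open_greaterThan)
  then show ?thesis by (simp add: DERIV_deriv_iff_real_differentiable)
qed

text \<open>The right derivative of \<open>H_increment\<close> at \<open>d = 0\<close>, with
  \<open>H\<close> replaced by \<open>x h(x) / \<gamma>\<close>. If it failed, the gap between the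
  two sides, which is 0 at \<open>d = 0\<close>, would become negative just to the right.\<close>

lemma h_derivative_ge:
  assumes x: "x > 0"
  shows "(h x + x * deriv h x) / \<gamma> \<ge>
    ((1 - \<alpha>) * x) powr (- \<gamma>) * h x - \<gamma> / ((1 - \<alpha>) * x) * (x * h x / \<gamma>)"
proof (rule ccontr)
  define c where "c = (1 - \<alpha>) * x"
  have c: "c > 0" using x params by (simp add: c_def)
  define I where "I = (\<lambda>y. integral {x..y} h)"
  define F where "F = (\<lambda>y. (1 + (y - x) / c) powr (- \<gamma>))"
  define G where "G = (\<lambda>y. (c + (y - x)) powr (- \<gamma>))"
  \<comment> \<open>The gap in \<open>H_increment\<close> as a function of the end point
    \<open>y = x + d\<close>.\<close>
  define D where "D = (\<lambda>y. y * h y / \<gamma> - x * h x / \<gamma> * F y - G y * I y)"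
  have D_nonneg: "D (x + d) \<ge> 0" if "d > 0" for d
    using H_increment[OF x, of d] H_eq x that by (simp add: D_def F_def G_def I_def c_def)
  have at_x: "F x = 1" "G x = c powr (- \<gamma>)" "I x = 0"
    using c by (simp_all add: F_def G_def I_def)
  then have D_x: "D x = 0" by (simp add: D_def)
  have dI: "(I has_real_derivative h x) (at x within {x..x+1})"
    unfolding I_def by (rule integral_has_real_derivative)
       (use x in \<open>auto intro: continuous_on_subset[OF h_continuous]\<close>)
  have dh: "(h has_real_derivative deriv h x) (at x within {x..x+1})"
    using h_has_derivative[OF x] by (rule has_field_derivative_at_within)
  have dF: "(F has_real_derivative - \<gamma> / c) (at x within {x..x+1})"
    unfolding F_def using c by (auto intro!: derivative_eq_intros)
  have dG: "(G has_real_derivative (- \<gamma> * c powr (- \<gamma> - 1))) (at x within {x..x+1})"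
    unfolding G_def using c by (auto intro!: derivative_eq_intros)
  have "(D has_real_derivative
     (h x + x * deriv h x) / \<gamma> - x * h x / \<gamma> * (- \<gamma> / c) - c powr (- \<gamma>) * h x) (at x within {x..x+1})"
    unfolding D_def using gamma_pos
    by (auto intro!: derivative_eq_intros dI dh dF dG simp: at_x)
  moreover assume "\<not> ?thesis"
  then have "(h x + x * deriv h x) / \<gamma> - x * h x / \<gamma> * (- \<gamma> / c) - c powr (- \<gamma>) * h x < 0"
    unfolding c_def[symmetric] by (simp add: mult.commute)
  ultimately obtain e where e: "e > 0" "\<And>d. d > 0 \<Longrightarrow> x + d \<in> {x..x+1} \<Longrightarrow> d < e \<Longrightarrow> D x > D (x + d)"
    using has_real_derivative_neg_dec_right by blast
  \<comment> \<open>The minimum keeps the point inside \<open>{x..x+1}\<close>, where the one-sided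
    derivative is taken, and closer to \<open>x\<close> than \<open>e\<close>.\<close>
  have "D x > D (x + min 1 (e / 2))" using e(1) by (intro e(2)) auto
  then show False using D_x D_nonneg[of "min 1 (e / 2)"] e(1) by simp
qed

text \<open>The derivative of \<open>Phi\<close> is a nonnegative factor times the slack in
  \<open>h_derivative_ge\<close>: the exponential accounts for the term with
  \<open>((1 - \<alpha>) x) powr (- \<gamma>)\<close>, the power of \<open>x\<close> for the
  remaining one.\<close>

lemma Phi_mono:
  assumes "0 < x" "x \<le> y"
  shows "Phi x \<le> Phi y"
proof (rule DERIV_nonneg_imp_nondecreasing[OF assms(2)])
  fix z assume "x \<le> z"
  with assms have z: "z > 0" by simp
  define b where "b = \<gamma> / (1 - \<alpha>)"
  define E where "E = exp (((1 - \<alpha>) * z) powr (- \<gamma>))"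
  define Q where "Q = ((1 - \<alpha>) * z) powr (- \<gamma>)"
  have cz: "(1 - \<alpha>) * z > 0" using z params by simp
  define R where "R = (\<lambda>x. ((1 - \<alpha>) * x) powr (- \<gamma>))"
  define S where "S = (\<lambda>x::real. x powr (b + 1))"
  have dR: "(R has_real_derivative - \<gamma> * Q / z) (at z)"
  proof -
    have "(R has_real_derivative (- \<gamma>) * ((1 - \<alpha>) * z) powr (- \<gamma> - 1) * (1 - \<alpha>)) (at z)"
      unfolding R_def using cz by (auto intro!: derivative_eq_intros)
    also have "(- \<gamma>) * ((1 - \<alpha>) * z) powr (- \<gamma> - 1) * (1 - \<alpha>) = - \<gamma> * Q / z"
      using cz z by (simp add: Q_def powr_diff)
    finally show ?thesis .
  qed
  have dS: "(S has_real_derivative (b + 1) * z powr b) (at z)"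
    unfolding S_def using z by (auto intro!: derivative_eq_intros)
  have Phi: "Phi = (\<lambda>x. h x * S x * exp (R x))"
    by (simp add: fun_eq_iff Phi_def S_def R_def b_def)
  have at_z: "S z = z powr (b + 1)" "exp (R z) = E" by (simp_all add: S_def R_def E_def)
  have "(Phi has_real_derivative
     (deriv h z * z powr (b + 1) + h z * ((b + 1) * z powr b)) * E +
     h z * z powr (b + 1) * (E * (- \<gamma> * Q / z))) (at z)"
    unfolding Phi
    by (rule derivative_eq_intros h_has_derivative[OF z] dR dS refl)+ (simp add: at_z algebra_simps)
  also have "(deriv h z * z powr (b + 1) + h z * ((b + 1) * z powr b)) * E +
     h z * z powr (b + 1) * (E * (- \<gamma> * Q / z)) =
     \<gamma> * z powr b * E * ((h z + z * deriv h z) / \<gamma> - (Q * h z - b / \<gamma> * h z))"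
    using z gamma_pos by (simp add: powr_add field_simps)
  finally have deriv: "(Phi has_real_derivative
     \<gamma> * z powr b * E * ((h z + z * deriv h z) / \<gamma> - (Q * h z - b / \<gamma> * h z))) (at z)" .
  have eq: "\<gamma> / ((1 - \<alpha>) * z) * (z * h z / \<gamma>) = b / \<gamma> * h z"
    using z params by (simp add: b_def)
  have "(h z + z * deriv h z) / \<gamma> - (Q * h z - b / \<gamma> * h z) \<ge> 0"
    using h_derivative_ge[OF z] unfolding eq Q_def by linarith
  then have "0 \<le> \<gamma> * z powr b * E * ((h z + z * deriv h z) / \<gamma> - (Q * h z - b / \<gamma> * h z))"
    using gamma_pos z by (intro mult_nonneg_nonneg) (auto simp: E_def)
  with deriv show "\<exists>d. (Phi has_real_derivative d) (at z) \<and> 0 \<le> d" by blast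
qed

lemma Phi_nonneg: "x > 0 \<Longrightarrow> Phi x \<ge> 0"
  using h_nonneg by (simp add: Phi_def)

text \<open>Defined as an infimum, which exists because \<open>Phi\<close> is nonnegative;
  monotonicity makes it the limit at \<open>0+\<close>.\<close>

definition L :: real where "L = Inf (Phi ` {0<..})"

lemma Phi_ge_L: "x > 0 \<Longrightarrow> L \<le> Phi x"
  unfolding L_def by (rule cInf_lower) (auto intro!: bdd_belowI2[of _ 0] Phi_nonneg)

lemma L_nonneg: "L \<ge> 0"
  unfolding L_def by (rule cInf_greatest) (auto intro: Phi_nonneg)

lemma Phi_near_L:
  assumes "e > 0"
  obtains d where "d > 0" "\<And>x. 0 < x \<Longrightarrow> x \<le> d \<Longrightarrow> Phi x < L + e"
proof -
  have "\<exists>y\<in>Phi ` {0<..}. y < L + e"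
    using assms unfolding L_def by (intro cInf_lessD) auto
  then obtain d where "d > 0" "Phi d < L + e" by auto
  with Phi_mono that show ?thesis by (meson le_less_trans)
qed

lemma Phi_tendsto_L: "(Phi \<longlongrightarrow> L) (at_right 0)"
proof (rule order_tendstoI)
  fix b assume "b < L"
  with Phi_ge_L show "\<forall>\<^sub>F x in at_right 0. b < Phi x"
    by (intro eventually_at_rightI[of 0 1]) (auto intro: less_le_trans)
next
  fix b assume "L < b"
  then obtain d where "d > 0" "\<And>x. 0 < x \<Longrightarrow> x \<le> d \<Longrightarrow> Phi x < b"
    using Phi_near_L[of "b - L"] by auto
  then show "\<forall>\<^sub>F x in at_right 0. Phi x < b"
    by (intro eventually_at_rightI[of 0 d]) auto
qed

end

section \<open>Moments\<close>

text \<open>Nonnegativity turns gauge integrability into absolute integrability, which the change of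
  variables theorem requires.\<close>

lemma nonneg_has_integral_substitution:
  fixes f g :: "real \<Rightarrow> real"
  assumes "S \<in> sets lebesgue"
    and "\<And>t. t \<in> S \<Longrightarrow> (g has_real_derivative g' t) (at t within S)"
    and "inj_on g S"
    and "((\<lambda>t. \<bar>g' t\<bar> * f (g t)) has_integral b) S"
    and "\<And>t. t \<in> S \<Longrightarrow> f (g t) \<ge> 0"
  shows "(f has_integral b) (g ` S)"
proof -
  have "(\<lambda>t. \<bar>g' t\<bar> * f (g t)) absolutely_integrable_on S"
    using assms by (intro nonnegative_absolutely_integrable_1) auto
  then have "f absolutely_integrable_on (g ` S) \<and> integral (g ` S) f = b"
    using has_absolute_integral_change_of_variables_1'[OF assms(1-3), of f b] assms(4)
    by (simp add: integral_unique)
  then show ?thesis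
    using set_lebesgue_integral_eq_integral(1) by blast
qed

section \<open>Growth of the Gamma function\<close>

text \<open>Euler's limit formula for \<open>Gamma a\<close>, inverted:
  \<open>pochhammer a (n + 1) * Gamma a = Gamma (n + a + 1)\<close>.\<close>

lemma Gamma_asymp_fact_powr:
  fixes a :: real
  assumes "a > 0"
  shows "(\<lambda>n. Gamma (real n + a + 1) / (fact n * real n powr a)) \<longlonglongrightarrow> 1"
proof -
  have np: "a \<notin> \<int>\<^sub>\<le>\<^sub>0" using assms by auto
  have "(\<lambda>n. Gamma a / Gamma_series a n) \<longlonglongrightarrow> Gamma a / Gamma a"
    using np by (intro tendsto_divide tendsto_const Gamma_series_LIMSEQ) (simp add: Gamma_eq_zero_iff)
  then have lim: "(\<lambda>n. Gamma a / Gamma_series a n) \<longlonglongrightarrow> 1"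
    using np by (simp add: Gamma_eq_zero_iff)
  have eq: "Gamma a / Gamma_series a n = Gamma (real n + a + 1) / (fact n * real n powr a)" if "n > 0" for n
  proof -
    have "pochhammer a (n + 1) = Gamma (real n + a + 1) / Gamma a"
      using pochhammer_Gamma[OF np, of "n + 1"] by (simp add: algebra_simps)
    then show ?thesis
      using that np by (simp add: Gamma_series_def powr_def Gamma_eq_zero_iff)
  qed
  have "\<forall>\<^sub>F n in sequentially. Gamma a / Gamma_series a n = Gamma (real n + a + 1) / (fact n * real n powr a)"
    by (rule eventually_mono[OF eventually_gt_at_top[of 0]]) (rule eq)
  with lim show ?thesis by (rule Lim_transform_eventually)
qed

text \<open>Shows that the part of the moments coming from \<open>x\<close> away from 0, which grows
  only geometrically, is negligible.\<close>

lemma power_over_Gamma_tendsto_0: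
  fixes a B :: real
  assumes "a > 0"
  shows "(\<lambda>n. B ^ n / Gamma (real n + a + 1)) \<longlonglongrightarrow> 0"
proof -
  have "(\<lambda>n. inverse (fact n) * B ^ n) \<longlonglongrightarrow> 0"
    by (rule summable_LIMSEQ_zero[OF summable_exp])
  moreover have "(\<lambda>n. real n powr (- a)) \<longlonglongrightarrow> 0"
    using assms by (intro tendsto_neg_powr filterlim_real_sequentially) auto
  moreover note Gamma_asymp_fact_powr[OF assms]
  ultimately have "(\<lambda>n. inverse (fact n) * B ^ n * real n powr (- a) /
      (Gamma (real n + a + 1) / (fact n * real n powr a))) \<longlonglongrightarrow> 0 * 0 / 1"
    by (intro tendsto_mult tendsto_divide) auto
  then have lim: "(\<lambda>n. inverse (fact n) * B ^ n * real n powr (- a) /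
      (Gamma (real n + a + 1) / (fact n * real n powr a))) \<longlonglongrightarrow> 0" by simp
  have eq: "inverse (fact n) * B ^ n * real n powr (- a) /
      (Gamma (real n + a + 1) / (fact n * real n powr a)) = B ^ n / Gamma (real n + a + 1)" if "n > 0" for n
    using that by (simp add: powr_minus field_simps)
  have "\<forall>\<^sub>F n in sequentially. inverse (fact n) * B ^ n * real n powr (- a) /
      (Gamma (real n + a + 1) / (fact n * real n powr a)) = B ^ n / Gamma (real n + a + 1)"
    by (rule eventually_mono[OF eventually_gt_at_top[of 0]]) (rule eq)
  with lim show ?thesis by (rule Lim_transform_eventually)
qed

context sun_law
begin

section \<open>Two integrals evaluated by substitution\<close>

definition Y :: "real \<Rightarrow> real" where
  "Y x = ((1 - \<alpha>) * x) powr (- \<gamma>)"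

lemma Y_nonneg [simp]: "Y x \<ge> 0"
  by (simp add: Y_def)

lemma kernel_nonneg: "0 \<le> x \<Longrightarrow> 0 \<le> \<gamma> / x * Y x ^ n * (x - \<alpha> * u) powr (- \<gamma>)"
  using gamma_pos
  by (intro mult_nonneg_nonneg divide_nonneg_nonneg zero_le_power powr_ge_zero Y_nonneg) auto

lemma Y_measurable [measurable]: "Y \<in> borel_measurable borel"
  unfolding Y_def by measurable

text \<open>Substitute \<open>x = u * t powr (- (1 / \<gamma>))\<close>, which maps
  \<open>(0, 1)\<close> onto \<open>(u, \<infinity>)\<close>. Then \<open>Y x = t * Y u\<close>, the
  measure \<open>\<gamma> dx / x\<close> becomes \<open>dt / t\<close>, and
  \<open>x - \<alpha> u\<close> is \<open>(1 - \<alpha>) x\<close> times the base in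
  \<open>sun_G_has_integral\<close>.\<close>

lemma kernel_has_integral:
  assumes u: "u > 0"
  shows "((\<lambda>x. \<gamma> / x * Y x ^ n * (x - \<alpha> * u) powr (- \<gamma>)) has_integral
           Y u ^ Suc n * (sun_G \<alpha> \<gamma> (Suc n) / real (Suc n))) {u<..}"
proof -
  define f where "f = (\<lambda>x. \<gamma> / x * Y x ^ n * (x - \<alpha> * u) powr (- \<gamma>))"
  define g where "g = (\<lambda>t. u * t powr (- (1 / \<gamma>)))"
  define g' where "g' = (\<lambda>t. u * (- (1 / \<gamma>) * t powr (- (1 / \<gamma>) - 1)))"
  define K where "K = (\<lambda>t. (1 + \<alpha> / (1 - \<alpha>) * root_gap \<gamma> t) powr (- \<gamma>))"
  have bounds: "t powr (1 / \<gamma>) < 1" if "t \<in> {0<..<1}" for t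
    using that gamma_pos powr_less_mono2[of "1 / \<gamma>" t 1] by simp
  have pos: "f (g t) \<ge> 0" if t: "t \<in> {0<..<1}" for t
    using u unfolding f_def by (intro kernel_nonneg) (simp add: g_def)
  have subst: "\<bar>g' t\<bar> * f (g t) = Y u ^ Suc n * (t ^ n * K t)" if t: "t \<in> {0<..<1}" for t
  proof -
    define r where "r = t powr (1 / \<gamma>)"
    have r: "0 < r" "r < 1" using bounds[OF t] t by (auto simp: r_def)
    have g: "g t = u / r" by (simp add: g_def r_def powr_minus_divide)
    have g': "\<bar>g' t\<bar> = u / (\<gamma> * r * t)"
      using u gamma_pos t by (simp add: g'_def r_def powr_diff powr_minus_divide abs_mult)
    have rg: "r powr \<gamma> = t" using t gamma_pos by (simp add: r_def powr_powr)
    have Yg: "Y (g t) = Y u * t"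
    proof -
      have "Y (g t) = ((1 - \<alpha>) * u) powr (- \<gamma>) * (1 / r) powr (- \<gamma>)"
        unfolding Y_def g by (subst powr_mult[symmetric]) simp
      also have "(1 / r) powr (- \<gamma>) = t"
        using r rg by (simp add: powr_divide powr_minus_divide)
      finally show ?thesis by (simp add: Y_def)
    qed
    have "g t - \<alpha> * u = ((1 - \<alpha>) * g t) * (1 + \<alpha> / (1 - \<alpha>) * root_gap \<gamma> t)"
      using r params by (simp add: g root_gap_def r_def[symmetric] field_simps)
    then have "(g t - \<alpha> * u) powr (- \<gamma>) = Y u * t * K t"
      by (simp add: powr_mult K_def Yg[symmetric] Y_def[of "g t"])
    then have "\<bar>g' t\<bar> * f (g t) = u / (\<gamma> * r * t) * (\<gamma> / (u / r) * (Y u * t) ^ n * (Y u * t * K t))"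
      by (simp add: f_def g' Yg) (simp add: g)
    also have "\<dots> = Y u ^ Suc n * (t ^ n * K t)"
      using u r t gamma_pos by (simp add: power_mult_distrib field_simps)
    finally show ?thesis .
  qed
  have "((\<lambda>t. Y u ^ Suc n / real (Suc n) * (real (Suc n) * t ^ n * K t)) has_integral
          Y u ^ Suc n / real (Suc n) * sun_G \<alpha> \<gamma> (Suc n)) {0<..<1}"
    using sun_G_has_integral[OF params, of "Suc n"]
    by (intro has_integral_mult_right) (simp add: K_def has_integral_Icc_iff_Ioo del: of_nat_Suc)
  then have "((\<lambda>t. \<bar>g' t\<bar> * f (g t)) has_integral
      Y u ^ Suc n * (sun_G \<alpha> \<gamma> (Suc n) / real (Suc n))) {0<..<1}"
    by (rule has_integral_eq_rhs[OF has_integral_eq, rotated])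
       (auto simp: subst simp del: of_nat_Suc power_Suc)
  then have "(f has_integral Y u ^ Suc n * (sun_G \<alpha> \<gamma> (Suc n) / real (Suc n))) (g ` {0<..<1})"
  proof (rule nonneg_has_integral_substitution[rotated 3])
    show "(g has_real_derivative g' t) (at t within {0<..<1})" if "t \<in> {0<..<1}" for t
      unfolding g_def g'_def using that by (auto intro!: derivative_eq_intros)
    show "inj_on g {0<..<1}"
      by (rule inj_on_inverseI[where g = "\<lambda>x. (u / x) powr \<gamma>"])
         (use u gamma_pos in \<open>auto simp: g_def powr_minus_divide powr_powr\<close>)
  qed (use pos in auto)
  moreover have "g ` {0<..<1} = {u<..}"
  proof (intro equalityI subsetI)
    fix x assume "x \<in> g ` {0<..<1}"
    then obtain t where t: "t \<in> {0<..<1}" "x = g t" by auto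
    have "u * 1 < u * (1 / t powr (1 / \<gamma>))"
      using bounds[OF t(1)] t(1) u by (intro mult_strict_left_mono) auto
    then show "x \<in> {u<..}" using t by (simp add: g_def powr_minus_divide)
  next
    fix x assume x: "x \<in> {u<..}"
    have "(u / x) powr \<gamma> < 1 powr \<gamma>" using x u gamma_pos by (intro powr_less_mono2) auto
    moreover have "x = g ((u / x) powr \<gamma>)"
      using x u gamma_pos by (simp add: g_def powr_powr powr_minus_divide)
    ultimately show "x \<in> g ` {0<..<1}" using x u by (intro image_eqI[of _ _ "(u / x) powr \<gamma>"]) auto
  qed
  ultimately show ?thesis by (simp add: f_def)
qed

text \<open>Substituting \<open>t = Y x\<close> gives Euler's integral for \<open>Gamma\<close>; the
  shift comes from \<open>\<gamma> / (1 - \<alpha>) = \<gamma> (a + 1)\<close> with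
  \<open>a = \<alpha> / (1 - \<alpha>)\<close>.\<close>

lemma weight_has_integral:
  "((\<lambda>x. Y x ^ n * x powr (- (\<gamma> / (1 - \<alpha>)) - 1) * exp (- Y x)) has_integral
     (1 - \<alpha>) powr (\<gamma> / (1 - \<alpha>)) / \<gamma> * Gamma (real n + \<alpha> / (1 - \<alpha>) + 1)) {0<..}"
proof -
  define b where "b = \<gamma> / (1 - \<alpha>)"
  define a where "a = \<alpha> / (1 - \<alpha>)"
  have a: "a > 0" using params by (simp add: a_def)
  have b: "b / \<gamma> = a + 1" using params by (simp add: a_def b_def field_simps)
  define f where "f = (\<lambda>x. Y x ^ n * x powr (- b - 1) * exp (- Y x))"
  define g where "g = (\<lambda>t. t powr (- (1 / \<gamma>)) / (1 - \<alpha>))"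
  define g' where "g' = (\<lambda>t. - (1 / \<gamma>) * t powr (- (1 / \<gamma>) - 1) / (1 - \<alpha>))"
  have subst: "\<bar>g' t\<bar> * f (g t) = (1 - \<alpha>) powr b / \<gamma> * (t powr (real n + a + 1 - 1) / exp t)"
    if t: "t > 0" for t
  proof -
    have Y: "Y (g t) = t" using t params by (simp add: Y_def g_def powr_powr)
    have "g t powr (- b - 1) = (t powr (- (1 / \<gamma>))) powr (- b - 1) * (1 / (1 - \<alpha>)) powr (- b - 1)"
      unfolding g_def by (subst powr_mult[symmetric]) simp
    also have "(1 / (1 - \<alpha>)) powr (- b - 1) = (1 - \<alpha>) powr (b + 1)"
      using params by (simp add: powr_divide powr_minus_divide[of _ "b + 1", simplified])
    also have "(t powr (- (1 / \<gamma>))) powr (- b - 1) = t powr (a + 1 + 1 / \<gamma>)"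
    proof -
      have "- (1 / \<gamma>) * (- b - 1) = b / \<gamma> + 1 / \<gamma>" by (simp add: algebra_simps)
      then show ?thesis unfolding powr_powr b by simp
    qed
    finally have g: "g t powr (- b - 1) = t powr (a + 1 + 1 / \<gamma>) * (1 - \<alpha>) powr (b + 1)" .
    have "\<bar>g' t\<bar> * f (g t) =
        (1 / \<gamma> * t powr (- (1 / \<gamma>) - 1) / (1 - \<alpha>)) *
        (t powr real n * (t powr (a + 1 + 1 / \<gamma>) * (1 - \<alpha>) powr (b + 1)) * exp (- t))"
      using params t by (simp add: f_def g'_def Y g abs_mult powr_realpow)
    also have "\<dots> = ((1 - \<alpha>) powr (b + 1) / (1 - \<alpha>)) / \<gamma> *
        ((t powr (- (1 / \<gamma>) - 1) * t powr real n * t powr (a + 1 + 1 / \<gamma>)) * exp (- t))"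
      by (simp add: mult_ac)
    also have "(1 - \<alpha>) powr (b + 1) / (1 - \<alpha>) = (1 - \<alpha>) powr b"
      using params by (simp add: powr_add)
    also have "t powr (- (1 / \<gamma>) - 1) * t powr real n * t powr (a + 1 + 1 / \<gamma>) =
        t powr (real n + a + 1 - 1)"
      by (simp flip: powr_add)
    finally show ?thesis by (simp add: exp_minus field_simps)
  qed
  have "((\<lambda>t. t powr (real n + a + 1 - 1) / exp t) has_integral Gamma (real n + a + 1)) {0<..}"
  proof (subst has_integral_spike_set_eq)
    show "negligible {t \<in> {0<..} - {0..}. t powr (real n + a + 1 - 1) / exp t \<noteq> 0}"
      by (rule negligible_subset[of "{}"]) auto
    show "negligible {t \<in> {0..} - {0<..}. t powr (real n + a + 1 - 1) / exp t \<noteq> 0}"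
      by (rule negligible_subset[of "{0}"]) auto
    show "((\<lambda>t. t powr (real n + a + 1 - 1) / exp t) has_integral Gamma (real n + a + 1)) {0..}"
      using a by (intro Gamma_integral_real) simp
  qed
  then have "((\<lambda>t. (1 - \<alpha>) powr b / \<gamma> * (t powr (real n + a + 1 - 1) / exp t)) has_integral
      (1 - \<alpha>) powr b / \<gamma> * Gamma (real n + a + 1)) {0<..}"
    by (rule has_integral_mult_right)
  then have "((\<lambda>t. \<bar>g' t\<bar> * f (g t)) has_integral
      (1 - \<alpha>) powr b / \<gamma> * Gamma (real n + a + 1)) {0<..}"
    by (rule has_integral_eq[rotated]) (use subst in auto)
  then have "(f has_integral (1 - \<alpha>) powr b / \<gamma> * Gamma (real n + a + 1)) (g ` {0<..})"
  proof (rule nonneg_has_integral_substitution[rotated 3])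
    show "(g has_real_derivative g' t) (at t within {0<..})" if "t \<in> {0<..}" for t
      unfolding g_def g'_def using that params by (auto intro!: derivative_eq_intros)
    show "inj_on g {0<..}"
      by (rule inj_on_inverseI[where g = "\<lambda>x. ((1 - \<alpha>) * x) powr (- \<gamma>)"])
         (use params in \<open>auto simp: g_def powr_powr\<close>)
    show "f (g t) \<ge> 0" if "t \<in> {0<..}" for t
      using that by (simp add: f_def)
  qed auto
  moreover have "g ` {0<..} = {0<..}"
  proof (intro equalityI subsetI)
    fix x :: real assume x: "x \<in> {0<..}"
    have "x = g (((1 - \<alpha>) * x) powr (- \<gamma>))"
      using x params by (simp add: g_def powr_powr)
    then show "x \<in> g ` {0<..}" by (rule image_eqI) (use x params in auto)
  qed (use params in \<open>auto simp: g_def\<close>)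
  ultimately show ?thesis by (simp add: f_def a_def b_def)
qed

section \<open>The moments of \<open>Y\<close> and their recursion\<close>

definition h0 :: "real \<Rightarrow> real" where "h0 x = indicator {0<..} x * h x"

lemma h0_measurable [measurable]: "h0 \<in> borel_measurable borel"
  using borel_measurable_integrable[OF h_integrable[unfolded set_integrable_def]]
  by (simp add: h0_def[abs_def])

lemma h0_nonneg: "h0 x \<ge> 0"
  using h_nonneg by (simp add: h0_def indicator_def)

text \<open>Taken in \<open>ennreal\<close> so that Tonelli applies before the moments are known to
  be finite.\<close>

definition moment :: "nat \<Rightarrow> ennreal" where
  "moment n = (\<integral>\<^sup>+x. ennreal (h0 x * Y x ^ n) \<partial>lborel)"

lemma moment_0: "moment 0 = 1"
proof -
  have "integrable lborel h0"
    using h_integrable by (simp add: set_integrable_def h0_def[abs_def])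
  then have "moment 0 = ennreal (integral\<^sup>L lborel h0)"
    unfolding moment_def using h0_nonneg by (simp add: nn_integral_eq_integral)
  also have "integral\<^sup>L lborel h0 = 1"
    using density by (simp add: sun_density_def set_lebesgue_integral_def h0_def[abs_def])
  finally show ?thesis by simp
qed

text \<open>The kernel of the integral equation, multiplied by \<open>Y x ^ n\<close> and extended
  by 0 to the whole plane, so that the order of integration can be exchanged without moving
  limits.\<close>

definition iter_kernel :: "nat \<Rightarrow> real \<Rightarrow> real \<Rightarrow> real" where
  "iter_kernel n x u = (if 0 < u \<and> u < x then \<gamma> / x * Y x ^ n * (x - \<alpha> * u) powr (- \<gamma>) else 0)"

lemma iter_kernel_measurable [measurable]:
  "(\<lambda>p. iter_kernel n (fst p) (snd p)) \<in> borel_measurable (lborel \<Otimes>\<^sub>M lborel)"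
  unfolding iter_kernel_def by measurable

lemma iter_kernel_nonneg: "iter_kernel n x u \<ge> 0"
  using kernel_nonneg[of x n u] by (simp add: iter_kernel_def)

lemma nn_integral_iter_kernel_left:
  assumes "u > 0"
  shows "(\<integral>\<^sup>+x. ennreal (iter_kernel n x u) \<partial>lborel) =
           ennreal (Y u ^ Suc n * (sun_G \<alpha> \<gamma> (Suc n) / real (Suc n)))"
proof -
  have "(\<integral>\<^sup>+x. ennreal (iter_kernel n x u) \<partial>lborel) = (\<integral>\<^sup>+x. ennreal (indicator {u<..} x *
           (\<gamma> / x * Y x ^ n * (x - \<alpha> * u) powr (- \<gamma>))) \<partial>lborel)"
    using assms by (intro nn_integral_cong) (simp add: iter_kernel_def indicator_def)
  also have "\<dots> = ennreal (Y u ^ Suc n * (sun_G \<alpha> \<gamma> (Suc n) / real (Suc n)))"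
  proof (rule nn_integral_has_integral_lebesgue[OF _ kernel_has_integral[OF assms]])
    show "0 \<le> \<gamma> / x * Y x ^ n * (x - \<alpha> * u) powr (- \<gamma>)" if "x \<in> {u<..}" for x
      using that assms by (intro kernel_nonneg) simp
  qed
  finally show ?thesis .
qed

lemma nn_integral_iter_kernel_right:
  "(\<integral>\<^sup>+u. ennreal (iter_kernel n x u * h0 u) \<partial>lborel) = ennreal (h0 x * Y x ^ n)"
proof (cases "x > 0")
  case True
  have int: "set_integrable lborel {0<..<x} (\<lambda>u. h u * (x - \<alpha> * u) powr (- \<gamma>))"
    by (rule kernel_integrable) auto
  have "(\<integral>\<^sup>+u. ennreal (iter_kernel n x u * h0 u) \<partial>lborel) =
      (\<integral>\<^sup>+u. ennreal (\<gamma> / x * Y x ^ n * (indicator {0<..<x} u *\<^sub>R (h u * (x - \<alpha> * u) powr (- \<gamma>)))) \<partial>lborel)"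
    by (intro nn_integral_cong) (auto simp: iter_kernel_def h0_def indicator_def mult_ac)
  also have "\<dots> = ennreal (\<integral>u. \<gamma> / x * Y x ^ n * (indicator {0<..<x} u *\<^sub>R (h u * (x - \<alpha> * u) powr (- \<gamma>))) \<partial>lborel)"
  proof (rule nn_integral_eq_integral)
    show "integrable lborel (\<lambda>u. \<gamma> / x * Y x ^ n * (indicator {0<..<x} u *\<^sub>R (h u * (x - \<alpha> * u) powr (- \<gamma>))))"
      using int unfolding set_integrable_def by (rule integrable_mult_right)
    show "AE u in lborel. 0 \<le> \<gamma> / x * Y x ^ n * (indicator {0<..<x} u *\<^sub>R (h u * (x - \<alpha> * u) powr (- \<gamma>)))"
      using True gamma_pos h_nonneg by (intro AE_I2 mult_nonneg_nonneg) (auto simp: indicator_def)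
  qed
  also have "\<dots> = ennreal (\<gamma> / x * Y x ^ n * H x)"
    by (simp add: H_def set_lebesgue_integral_def)
  finally show ?thesis using True h_eq[OF True] by (simp add: h0_def mult_ac)
next
  case False
  then have "iter_kernel n x u = 0" for u by (simp add: iter_kernel_def)
  then show ?thesis using False by (simp add: h0_def)
qed

text \<open>Tonelli for \<open>iter_kernel n x u * h0 u\<close>: integrating over \<open>u\<close>
  first gives \<open>h0 x * Y x ^ n\<close> by the integral equation, integrating over
  \<open>x\<close> first gives \<open>sun_G\<close> by \<open>kernel_has_integral\<close>.\<close>

lemma moment_recurrence: "moment n = moment (Suc n) * ennreal (sun_G \<alpha> \<gamma> (Suc n) / real (Suc n))"
proof -
  define c where "c = sun_G \<alpha> \<gamma> (Suc n) / real (Suc n)"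
  have c: "c > 0" using sun_G_pos[OF params, of "Suc n"] by (simp add: c_def)
  have "moment n = (\<integral>\<^sup>+x. \<integral>\<^sup>+u. ennreal (iter_kernel n x u * h0 u) \<partial>lborel \<partial>lborel)"
    by (simp add: moment_def nn_integral_iter_kernel_right)
  also have "\<dots> = (\<integral>\<^sup>+u. \<integral>\<^sup>+x. ennreal (iter_kernel n x u * h0 u) \<partial>lborel \<partial>lborel)"
  proof -
    have "(\<lambda>(x, u). ennreal (iter_kernel n x u * h0 u)) \<in> borel_measurable (lborel \<Otimes>\<^sub>M lborel)"
      unfolding case_prod_unfold by measurable
    from lborel_pair.Fubini'[OF this] show ?thesis by simp
  qed
  also have "\<dots> = (\<integral>\<^sup>+u. ennreal (h0 u * Y u ^ Suc n) * ennreal c \<partial>lborel)"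
  proof (rule nn_integral_cong)
    fix u
    have "(\<integral>\<^sup>+x. ennreal (iter_kernel n x u * h0 u) \<partial>lborel) = (\<integral>\<^sup>+x. ennreal (iter_kernel n x u) * ennreal (h0 u) \<partial>lborel)"
      using h0_nonneg iter_kernel_nonneg by (simp add: ennreal_mult)
    also have "\<dots> = (\<integral>\<^sup>+x. ennreal (iter_kernel n x u) \<partial>lborel) * ennreal (h0 u)"
      by (rule nn_integral_multc) (unfold iter_kernel_def, measurable)
    also have "\<dots> = ennreal (h0 u * Y u ^ Suc n) * ennreal c"
    proof (cases "u > 0")
      case True
      have "(\<integral>\<^sup>+x. ennreal (iter_kernel n x u) \<partial>lborel) * ennreal (h0 u) =
          ennreal (Y u ^ Suc n * c) * ennreal (h0 u)"
        by (simp only: nn_integral_iter_kernel_left[OF True] c_def)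
      also have "\<dots> = ennreal (Y u ^ Suc n * c * h0 u)"
        using h0_nonneg c by (intro ennreal_mult[symmetric] mult_nonneg_nonneg zero_le_power) auto
      also have "Y u ^ Suc n * c * h0 u = h0 u * Y u ^ Suc n * c" by (simp only: mult_ac)
      also have "ennreal \<dots> = ennreal (h0 u * Y u ^ Suc n) * ennreal c"
        using h0_nonneg c by (intro ennreal_mult mult_nonneg_nonneg zero_le_power) auto
      finally show ?thesis .
    qed (simp add: h0_def)
    finally show "(\<integral>\<^sup>+x. ennreal (iter_kernel n x u * h0 u) \<partial>lborel) = ennreal (h0 u * Y u ^ Suc n) * ennreal c" .
  qed
  also have "\<dots> = moment (Suc n) * ennreal c"
    unfolding moment_def by (rule nn_integral_multc) simp
  finally show ?thesis by (simp add: c_def)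
qed

lemma moment_eq: "moment n = ennreal (fact n / (\<Prod>k<n. sun_G \<alpha> \<gamma> (Suc k)))"
proof (induction n)
  case 0
  show ?case by (simp add: moment_0)
next
  case (Suc n)
  define c where "c = sun_G \<alpha> \<gamma> (Suc n) / real (Suc n)"
  have c: "c > 0" using sun_G_pos[OF params, of "Suc n"] by (simp add: c_def)
  have P: "(\<Prod>k<m. sun_G \<alpha> \<gamma> (Suc k)) > 0" for m by (intro prod_pos) (simp add: sun_G_pos[OF params])
  \<comment> \<open>Multiplying by \<open>1 = c * (1 / c)\<close> solves the recurrence without
    assuming \<open>moment (Suc n)\<close> finite; finiteness follows.\<close>
  have "moment (Suc n) = moment (Suc n) * ennreal (c * (1 / c))" using c by simp
  also have "\<dots> = moment (Suc n) * ennreal c * ennreal (1 / c)"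
    using c by (simp only: ennreal_mult mult.assoc less_imp_le divide_nonneg_pos zero_le_one)
  also have "moment (Suc n) * ennreal c = moment n"
    unfolding c_def by (rule moment_recurrence[symmetric])
  also have "moment n * ennreal (1 / c) = ennreal (fact n / (\<Prod>k<n. sun_G \<alpha> \<gamma> (Suc k)) * (1 / c))"
    unfolding Suc.IH using P[of n] c by (intro ennreal_mult[symmetric]) auto
  also have "fact n / (\<Prod>k<n. sun_G \<alpha> \<gamma> (Suc k)) * (1 / c) =
      fact (Suc n) / (\<Prod>k<Suc n. sun_G \<alpha> \<gamma> (Suc k))"
    by (simp add: c_def)
  finally show ?case .
qed

section \<open>Identification of the limit\<close>

text \<open>Chosen so that the integrand of \<open>moment n\<close> is
  \<open>Phi x * weight n x\<close>; its total mass is \<open>W n\<close>.\<close>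

definition weight :: "nat \<Rightarrow> real \<Rightarrow> real" where
  "weight n x = indicator {0<..} x * (Y x ^ n * x powr (- (\<gamma> / (1 - \<alpha>)) - 1) * exp (- Y x))"

definition W :: "nat \<Rightarrow> real" where
  "W n = (1 - \<alpha>) powr (\<gamma> / (1 - \<alpha>)) / \<gamma> * Gamma (real n + \<alpha> / (1 - \<alpha>) + 1)"

definition moment_value :: "nat \<Rightarrow> real" where
  "moment_value n = fact n / (\<Prod>k<n. sun_G \<alpha> \<gamma> (Suc k))"

lemma weight_measurable [measurable]: "weight n \<in> borel_measurable borel"
  unfolding weight_def by measurable

lemma weight_nonneg: "weight n x \<ge> 0"
  by (simp add: weight_def)

lemma W_pos: "W n > 0"
proof -
  have "Gamma (real n + \<alpha> / (1 - \<alpha>) + 1) > 0"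
    using params by (intro Gamma_real_pos add_nonneg_pos) auto
  then show ?thesis using params by (simp add: W_def)
qed

lemma nn_integral_weight: "(\<integral>\<^sup>+x. ennreal (weight n x) \<partial>lborel) = ennreal (W n)"
  unfolding weight_def W_def
  by (rule nn_integral_has_integral_lebesgue[OF _ weight_has_integral]) simp

lemma moment_value_nonneg: "moment_value n \<ge> 0"
  unfolding moment_value_def using sun_G_pos[OF params]
  by (intro divide_nonneg_nonneg prod_nonneg) (auto intro: less_imp_le)

lemma h0_eq_Phi: "h0 x * Y x ^ n = Phi x * weight n x"
proof (cases "x > 0")
  case True
  have "Phi x * weight n x = h x * Y x ^ n *
      (x powr (\<gamma> / (1 - \<alpha>) + 1) * x powr (- (\<gamma> / (1 - \<alpha>)) - 1)) * (exp (Y x) * exp (- Y x))"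
    using True by (simp add: Phi_def weight_def Y_def[symmetric])
  also have "x powr (\<gamma> / (1 - \<alpha>) + 1) * x powr (- (\<gamma> / (1 - \<alpha>)) - 1) = 1"
    using True by (simp flip: powr_add)
  also have "exp (Y x) * exp (- Y x) = 1" by (simp flip: exp_add)
  finally show ?thesis using True by (simp add: h0_def)
qed (simp add: h0_def weight_def)

lemma moment_value_ge: "L * W n \<le> moment_value n"
proof -
  have "ennreal (L * W n) = (\<integral>\<^sup>+x. ennreal L * ennreal (weight n x) \<partial>lborel)"
    using L_nonneg W_pos[of n] by (simp add: nn_integral_cmult nn_integral_weight ennreal_mult)
  also have "\<dots> \<le> moment n"
    unfolding moment_def
  proof (rule nn_integral_mono)
    fix x
    have "L * weight n x \<le> h0 x * Y x ^ n"
    proof (cases "x > 0")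
      case True
      then show ?thesis using Phi_ge_L weight_nonneg by (simp add: h0_eq_Phi mult_right_mono)
    qed (simp add: weight_def h0_def)
    then show "ennreal L * ennreal (weight n x) \<le> ennreal (h0 x * Y x ^ n)"
      using L_nonneg weight_nonneg by (simp add: ennreal_leI flip: ennreal_mult)
  qed
  also have "\<dots> = ennreal (moment_value n)" by (simp add: moment_eq moment_value_def)
  finally show ?thesis using moment_value_nonneg by simp
qed

text \<open>Split at a \<open>d\<close> below which \<open>Phi < L + e\<close>. Beyond
  \<open>d\<close> the function \<open>Y\<close> is at most \<open>Y d\<close> and \<open>h0\<close>
  has total mass 1, so \<open>B = Y d\<close> works.\<close>

lemma moment_value_le:
  assumes "e > 0"
  obtains B where "\<And>n. moment_value n \<le> (L + e) * W n + B ^ n"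
proof -
  obtain d where d: "d > 0" "\<And>x. 0 < x \<Longrightarrow> x \<le> d \<Longrightarrow> Phi x < L + e"
    using Phi_near_L[OF assms] by blast
  have bound: "h0 x * Y x ^ n \<le> (L + e) * weight n x + Y d ^ n * h0 x" for x n
  proof -
    consider "x \<le> 0" | "0 < x" "x \<le> d" | "d < x" by linarith
    then show ?thesis
    proof cases
      case 1
      then show ?thesis by (simp add: h0_def weight_def)
    next
      case 2
      then have "Phi x * weight n x \<le> (L + e) * weight n x"
        using d(2)[of x] weight_nonneg by (intro mult_right_mono) auto
      moreover have "Y d ^ n * h0 x \<ge> 0" using h0_nonneg by simp
      ultimately show ?thesis unfolding h0_eq_Phi by linarith
    next
      case 3
      have "Y x \<le> Y d"
        unfolding Y_def using params 3 d(1) by (intro powr_mono2') auto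
      then have "h0 x * Y x ^ n \<le> h0 x * Y d ^ n"
        using h0_nonneg by (intro mult_left_mono power_mono) auto
      moreover have "(L + e) * weight n x \<ge> 0" using L_nonneg assms weight_nonneg by simp
      ultimately show ?thesis by (simp add: mult.commute)
    qed
  qed
  have "moment_value n \<le> (L + e) * W n + Y d ^ n" for n
  proof -
    have "ennreal (moment_value n) = moment n" by (simp add: moment_eq moment_value_def)
    \<comment> \<open>The factor \<open>Y x ^ 0\<close> is kept so that the second integral is
      literally \<open>moment 0\<close>, which is 1.\<close>
    also have "\<dots> \<le> (\<integral>\<^sup>+x. ennreal (L + e) * ennreal (weight n x) + ennreal (Y d ^ n) * ennreal (h0 x * Y x ^ 0) \<partial>lborel)"
      unfolding moment_def
    proof (rule nn_integral_mono)
      fix x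
      show "ennreal (h0 x * Y x ^ n) \<le>
          ennreal (L + e) * ennreal (weight n x) + ennreal (Y d ^ n) * ennreal (h0 x * Y x ^ 0)"
        using bound[of x n] L_nonneg assms weight_nonneg h0_nonneg
        by (simp add: ennreal_leI flip: ennreal_mult ennreal_plus)
    qed
    also have "\<dots> = ennreal (L + e) * ennreal (W n) + ennreal (Y d ^ n) * moment 0"
      unfolding moment_def by (subst nn_integral_add) (simp_all add: nn_integral_cmult nn_integral_weight)
    also have "\<dots> = ennreal ((L + e) * W n + Y d ^ n)"
      using L_nonneg assms W_pos[of n] by (simp add: moment_0 flip: ennreal_mult ennreal_plus)
    finally show ?thesis
      using L_nonneg assms W_pos[of n] by (subst (asm) ennreal_le_iff) auto
  qed
  then show ?thesis by (rule that)
qed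

text \<open>The quotient lies between \<open>L\<close> and \<open>L + e + B ^ n / W n\<close>, and
  the last term tends to 0 because \<open>W n\<close> grows like \<open>Gamma\<close>.\<close>

lemma moment_value_over_W_tendsto: "(\<lambda>n. moment_value n / W n) \<longlonglongrightarrow> L"
proof (rule order_tendstoI)
  fix b assume "b < L"
  moreover have "L \<le> moment_value n / W n" for n
    using moment_value_ge[of n] W_pos[of n] by (simp add: le_divide_eq)
  ultimately show "\<forall>\<^sub>F n in sequentially. b < moment_value n / W n"
    by (intro always_eventually allI) (auto intro: less_le_trans)
next
  fix b assume b: "L < b"
  define e where "e = (b - L) / 2"
  have e: "e > 0" using b by (simp add: e_def)
  obtain B where B: "\<And>n. moment_value n \<le> (L + e) * W n + B ^ n" using moment_value_le[OF e] by blast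
  define c where "c = (1 - \<alpha>) powr (\<gamma> / (1 - \<alpha>)) / \<gamma>"
  have "(\<lambda>n. B ^ n / Gamma (real n + \<alpha> / (1 - \<alpha>) + 1) / c) \<longlonglongrightarrow> 0 / c"
    using params by (intro tendsto_divide tendsto_const power_over_Gamma_tendsto_0) (auto simp: c_def)
  then have "(\<lambda>n. B ^ n / W n) \<longlonglongrightarrow> 0" by (simp add: W_def c_def mult_ac)
  then have "\<forall>\<^sub>F n in sequentially. B ^ n / W n < e" using e by (rule order_tendstoD)
  then show "\<forall>\<^sub>F n in sequentially. moment_value n / W n < b"
  proof eventually_elim
    case (elim n)
    have "moment_value n / W n \<le> ((L + e) * W n + B ^ n) / W n"
      using B[of n] W_pos[of n] by (intro divide_right_mono) auto
    also have "\<dots> = L + e + B ^ n / W n" using W_pos[of n] by (simp add: add_divide_distrib)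
    also have "\<dots> < L + e + e" using elim by simp
    finally show ?case by (simp add: e_def)
  qed
qed

section \<open>The infinite product and the value of the constant\<close>

lemma sun_factor_partial_prod:
  "(\<Prod>k<n. sun_factor \<alpha> \<gamma> (Suc k)) = moment_value n / fact n * exp (- (\<alpha> / (1 - \<alpha>)) * harm n)"
proof -
  have "(\<Prod>k<n. exp (\<alpha> / ((\<alpha> - 1) * real (Suc k)))) = exp (\<Sum>k<n. \<alpha> / ((\<alpha> - 1) * real (Suc k)))"
    by (simp add: exp_sum)
  also have "(\<Sum>k<n. \<alpha> / ((\<alpha> - 1) * real (Suc k))) = (\<Sum>k<n. - (\<alpha> / (1 - \<alpha>)) * inverse (real (Suc k)))"
  proof (rule sum.cong)
    fix k
    have "\<alpha> / (\<alpha> - 1) = - (\<alpha> / (1 - \<alpha>))" by (metis minus_diff_eq minus_divide_right)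
    then show "\<alpha> / ((\<alpha> - 1) * real (Suc k)) = - (\<alpha> / (1 - \<alpha>)) * inverse (real (Suc k))"
      by (simp only: divide_divide_eq_left[symmetric] divide_inverse[of _ "real (Suc k)"])
  qed simp
  also have "\<dots> = - (\<alpha> / (1 - \<alpha>)) * harm n"
    by (simp only: harm_altdef sum_distrib_left)
  finally show ?thesis
    by (simp add: sun_factor_def prod_dividef moment_value_def)
qed

text \<open>Write the product as \<open>moment_value n / W n\<close> times
  \<open>W n / (n! n powr a)\<close> times \<open>exp (- a (harm n - ln n))\<close>; the powers of
  \<open>n\<close> cancel and each factor has a known limit.\<close>

lemma sun_factor_partial_prod_tendsto:
  "(\<lambda>n. \<Prod>k<n. sun_factor \<alpha> \<gamma> (Suc k)) \<longlonglongrightarrow>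
     L * ((1 - \<alpha>) powr (\<gamma> / (1 - \<alpha>)) / \<gamma>) * exp (- (\<alpha> / (1 - \<alpha>)) * euler_mascheroni)"
proof -
  define a where "a = \<alpha> / (1 - \<alpha>)"
  define c where "c = (1 - \<alpha>) powr (\<gamma> / (1 - \<alpha>)) / \<gamma>"
  have a: "a > 0" and c: "c > 0" using params by (simp_all add: a_def c_def)
  have lim: "(\<lambda>n. moment_value n / W n * (c * (Gamma (real n + a + 1) / (fact n * real n powr a))) *
            exp (- a * (harm n - ln (real n)))) \<longlonglongrightarrow> L * (c * 1) * exp (- a * euler_mascheroni)"
    by (intro tendsto_intros moment_value_over_W_tendsto Gamma_asymp_fact_powr a euler_mascheroni_LIMSEQ)
  have eq: "moment_value n / W n * (c * (Gamma (real n + a + 1) / (fact n * real n powr a))) *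
        exp (- a * (harm n - ln (real n))) = (\<Prod>k<n. sun_factor \<alpha> \<gamma> (Suc k))" if "n > 0" for n
  proof -
    have "W n = c * Gamma (real n + a + 1)" by (simp add: W_def c_def a_def)
    moreover have "exp (- a * (harm n - ln (real n))) = exp (- a * harm n) * real n powr a"
      using that by (simp add: powr_def right_diff_distrib flip: exp_add)
    moreover have "Gamma (real n + a + 1) \<noteq> 0" using a by (intro less_imp_neq[symmetric] Gamma_real_pos) simp
    ultimately show ?thesis
      using that c by (simp add: sun_factor_partial_prod a_def[symmetric])
  qed
  have "\<forall>\<^sub>F n in sequentially. moment_value n / W n * (c * (Gamma (real n + a + 1) / (fact n * real n powr a))) *
        exp (- a * (harm n - ln (real n))) = (\<Prod>k<n. sun_factor \<alpha> \<gamma> (Suc k))"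
    by (rule eventually_mono[OF eventually_gt_at_top[of 0]]) (rule eq)
  from Lim_transform_eventually[OF lim this] show ?thesis
    by (simp add: a_def c_def)
qed

text \<open>The limit of the partial products is a multiple of \<open>L\<close> and stays above a
  positive constant.\<close>

lemma L_pos: "L > 0"
proof -
  obtain c where c: "c > 0" "\<And>n. c \<le> (\<Prod>k<n. sun_factor \<alpha> \<gamma> (Suc k))"
    using sun_factor_prod_bounded_below[OF params] by blast
  have "c \<le> L * ((1 - \<alpha>) powr (\<gamma> / (1 - \<alpha>)) / \<gamma>) * exp (- (\<alpha> / (1 - \<alpha>)) * euler_mascheroni)"
    using c(2) by (intro LIMSEQ_le_const[OF sun_factor_partial_prod_tendsto]) auto
  then have "L \<noteq> 0" using c(1) by auto
  then show ?thesis using L_nonneg by simp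
qed

lemma sun_factor_has_prod:
  "(\<lambda>k. sun_factor \<alpha> \<gamma> (Suc k)) has_prod
     (L * ((1 - \<alpha>) powr (\<gamma> / (1 - \<alpha>)) / \<gamma>) * exp (- (\<alpha> / (1 - \<alpha>)) * euler_mascheroni))"
proof -
  have "(\<lambda>n. \<Prod>k\<le>n. sun_factor \<alpha> \<gamma> (Suc k)) \<longlonglongrightarrow>
     L * ((1 - \<alpha>) powr (\<gamma> / (1 - \<alpha>)) / \<gamma>) * exp (- (\<alpha> / (1 - \<alpha>)) * euler_mascheroni)"
    using LIMSEQ_Suc[OF sun_factor_partial_prod_tendsto] by (simp only: lessThan_Suc_atMost)
  then show ?thesis
    \<comment> \<open>\<open>has_prod\<close> demands a nonzero limit of the partial products, hence
      \<open>L_pos\<close>.\<close>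
    using L_pos params by (simp add: has_prod_def raw_has_prod_def)
qed

text \<open>With \<open>Digamma 1 = - euler_mascheroni\<close>, the prefactors in
  \<open>sun_const\<close> are exactly the inverses of those in the value of the product, so only
  \<open>L\<close> remains.\<close>

lemma sun_const_eq_L: "sun_const \<alpha> \<gamma> = L"
proof -
  define a where "a = \<alpha> / (1 - \<alpha>)"
  define b where "b = \<gamma> / (1 - \<alpha>)"
  have "\<alpha> * Digamma 1 / (\<alpha> - 1) = a * euler_mascheroni"
    using params by (simp add: a_def divide_simps) (simp add: algebra_simps)
  moreover have "\<gamma> / (\<alpha> - 1) = - b"
    unfolding b_def by (metis minus_diff_eq minus_divide_right)
  moreover have "(\<Prod>k. sun_factor \<alpha> \<gamma> (Suc k)) =
      L * ((1 - \<alpha>) powr b / \<gamma>) * exp (- a * euler_mascheroni)"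
    using has_prod_unique[OF sun_factor_has_prod] by (simp add: a_def b_def)
  ultimately have "sun_const \<alpha> \<gamma> = \<gamma> * (1 - \<alpha>) powr (- b) * exp (a * euler_mascheroni) *
      (L * ((1 - \<alpha>) powr b / \<gamma>) * exp (- a * euler_mascheroni))"
    by (simp only: sun_const_def)
  also have "\<dots> = L * ((1 - \<alpha>) powr (- b) * (1 - \<alpha>) powr b) *
      (exp (a * euler_mascheroni) * exp (- a * euler_mascheroni))"
    using params by simp
  also have "(1 - \<alpha>) powr (- b) * (1 - \<alpha>) powr b = 1"
    using params by (simp flip: powr_add)
  also have "exp (a * euler_mascheroni) * exp (- a * euler_mascheroni) = 1"
    by (simp flip: exp_add)
  finally show ?thesis by simp
qed

lemma h_asymp_equiv:
  "h \<sim>[at_right 0] (\<lambda>x. L * x powr (- (\<gamma> / (1 - \<alpha>)) - 1) * exp (- (((1 - \<alpha>) * x) powr (- \<gamma>))))"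
proof (rule asymp_equivI')
  have "((\<lambda>x. Phi x / L) \<longlongrightarrow> L / L) (at_right 0)"
    using L_pos by (intro tendsto_divide Phi_tendsto_L tendsto_const) simp
  then have "((\<lambda>x. Phi x / L) \<longlongrightarrow> 1) (at_right 0)" using L_pos by simp
  moreover have "Phi x / L =
      h x / (L * x powr (- (\<gamma> / (1 - \<alpha>)) - 1) * exp (- (((1 - \<alpha>) * x) powr (- \<gamma>))))" if "x > 0" for x
  proof -
    have "x powr (- (\<gamma> / (1 - \<alpha>)) - 1) = 1 / x powr (\<gamma> / (1 - \<alpha>) + 1)"
      by (simp flip: powr_minus_divide)
    then show ?thesis by (simp add: Phi_def exp_minus field_simps)
  qed
  then have "\<forall>\<^sub>F x in at_right 0. Phi x / L =
      h x / (L * x powr (- (\<gamma> / (1 - \<alpha>)) - 1) * exp (- (((1 - \<alpha>) * x) powr (- \<gamma>))))"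
    by (auto intro: eventually_at_rightI[of 0 1])
  ultimately show "((\<lambda>x. h x / (L * x powr (- (\<gamma> / (1 - \<alpha>)) - 1) *
      exp (- (((1 - \<alpha>) * x) powr (- \<gamma>))))) \<longlongrightarrow> 1) (at_right 0)"
    by (rule Lim_transform_eventually)
qed

end

theorem theorem2:
  fixes \<alpha> \<gamma> :: real and h :: "real \<Rightarrow> real"
  assumes "0 < \<alpha>" and "\<alpha> < 1" and "\<gamma> > 0"
    and "sun_density \<alpha> \<gamma> h"
  shows "convergent_prod (\<lambda>k. sun_factor \<alpha> \<gamma> (Suc k)) \<and>
    sun_const \<alpha> \<gamma> > 0 \<and>
    h \<sim>[at_right 0] (\<lambda>x. sun_const \<alpha> \<gamma> * x powr (- (\<gamma> / (1 - \<alpha>)) - 1) *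
                          exp (- (((1 - \<alpha>) * x) powr (- \<gamma>))))"
proof -
  interpret sun_law \<alpha> \<gamma> h
    using assms by unfold_locales
  show ?thesis
    using sun_factor_has_prod L_pos h_asymp_equiv
    by (auto simp: sun_const_eq_L has_prod_iff)
qed

end
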